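(* Let $f\not\equiv 0$ be a bounded analytic function in $\mathbb{D}$, let $\gamma\in(0,1]$ and $p\in(1,\infty)$, and let $\lambda$ be the complete measure of $\log|f|$. Then $$m_p(r,\log|f|)=O\bigl((1-r)^{\gamma-1}\bigr),\quad r\uparrow 1,$$ holds if and only if $$\Bigl(\int_0^{2\pi}\lambda^p(\mathcal{C}(\varphi,\delta))\,d\varphi\Bigr)^{1/p}=O(\delta^\gamma),\quad 0<\delta<1.$$
   Context: $\mathbb{D}=\{z\in\mathbb{C}:|z|<1\}$. For $u$ subharmonic in $\mathbb{D}$ and $p\ge 1$, $m_p(r,u)=\bigl(\frac1{2\pi}\int_0^{2\pi}|u(re^{i\theta})|^p\,d\theta\bigr)^{1/p}$, $0<r<1$. Complete measure. Every subharmonic function $u\not\equiv-\infty$ in $\mathbb{D}$ bounded from above (in particular $u=\log|f|$ with $f$ bounded analytic) has a representation $$u(z)=\int_{\mathbb{D}}\log\frac{|z-\zeta|}{|1-z\bar\zeta|}\,d\mu_u(\zeta)-\frac1{2\pi}\int_{\partial\mathbb{D}}\frac{1-|z|^2}{|\zeta-z|^2}\,d\psi(\zeta)+C,$$ where $\mu_u$ is the Riesz measure of $u$ (for $u=\log|f|$ it is the counting measure of the zeros of $f$ with multiplicity), $\int_{\mathbb{D}}(1-|\zeta|)\,d\mu_u(\zeta)<\infty$, $\psi$ is a finite positive Borel measure on $\partial\mathbb{D}$, and $C$ is a real constant. The complete measure of $u$ (in the sense of Grishin) is the finite positive measure on $\overline{\mathbb{D}}$ given, for such a representation, by $$\lambda_u(M)=\int_{\mathbb{D}\cap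 M}(1-|\zeta|)\,d\mu_u(\zeta)+\psi(M\cap\partial\mathbb{D})$$ for Borel $M\subset\overline{\mathbb{D}}$. Carleson box: $\mathcal{C}(\varphi,\delta)=\{\zeta\in\overline{\mathbb{D}}:|\zeta|\ge 1-\delta,\ |\arg\zeta-\varphi|\le\pi\delta\}$, with the difference of arguments understood modulo $2\pi$. $\lambda^p(E)$ means $(\lambda(E))^p$. *)

theory Defs
  imports "HOL-Complex_Analysis.Complex_Analysis" "HOL-Library.Landau_Symbols"
begin

(* Extended-real logarithm with log 0 = -\<infinity>; the library's ln has ln 0 = 0. Used for x \<ge> 0. *)
definition elog :: "real \<Rightarrow> ereal" where
  "elog x = (if x = 0 then -\<infinity> else ereal (ln x))"

definition log_abs :: "(complex \<Rightarrow> complex) \<Rightarrow> complex \<Rightarrow> ereal" where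
  "log_abs f z = elog (cmod (f z))"

(* real_of_ereal sends -\<infinity> to 0; on a circle {|z| = r}, 0 < r < 1, this affects only a null set
   when u is subharmonic and not identically -\<infinity>. *)
definition m_mean :: "real \<Rightarrow> real \<Rightarrow> (complex \<Rightarrow> ereal) \<Rightarrow> real" where
  "m_mean p r u =
     (1 / (2 * pi) *
       (LBINT t:{0..2*pi}. \<bar>real_of_ereal (u (of_real r * cis t))\<bar> powr p)) powr (1 / p)"

(* Riesz measure of log |f| on the unit disc: each zero carries its multiplicity as mass.
   At a point where f does not vanish, zorder is 0. *)
definition zero_measure :: "(complex \<Rightarrow> complex) \<Rightarrow> complex measure" where
  "zero_measure f =
     density (count_space (ball 0 1)) (\<lambda>\<zeta>. of_nat (nat (zorder f \<zeta>)))"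

(* Minus the logarithmic term of the representation. The integrand -log(|z-\<zeta>| / |1 - z cnj \<zeta>|)
   lies in [0, \<infinity>] on the disc, so the integral always exists there, possibly as \<infinity>. *)
definition green_potential :: "complex measure \<Rightarrow> complex \<Rightarrow> ennreal" where
  "green_potential \<mu> z =
     (\<integral>\<^sup>+\<zeta>\<in>ball 0 1. e2ennreal (- elog (cmod (z - \<zeta>) / cmod (1 - z * cnj \<zeta>))) \<partial>\<mu>)"

definition poisson_integral :: "complex measure \<Rightarrow> complex \<Rightarrow> real" where
  "poisson_integral \<psi> z =
     1 / (2 * pi) * (LINT \<zeta>|\<psi>. (1 - (cmod z)\<^sup>2) / (cmod (\<zeta> - z))\<^sup>2)"

definition represented_by ::
  "(complex \<Rightarrow> ereal) \<Rightarrow> complex measure \<Rightarrow> complex measure \<Rightarrow> real \<Rightarrow> bool" where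
  "represented_by u \<mu> \<psi> C \<longleftrightarrow>
     (\<integral>\<^sup>+\<zeta>\<in>ball 0 1. ennreal (1 - cmod \<zeta>) \<partial>\<mu>) < \<infinity> \<and>
     finite_measure \<psi> \<and> sets \<psi> = sets (restrict_space borel (sphere 0 1)) \<and>
     (\<forall>z\<in>ball 0 1.
        u z = - enn2ereal (green_potential \<mu> z) - ereal (poisson_integral \<psi> z) + ereal C)"

(* A relation rather than a function of u: C can be traded against a multiple of arc length in \<psi>,
   so different representations of the same u give different complete measures.
   The argument \<mu> is the Riesz measure of u. *)
definition is_complete_measure ::
  "(complex \<Rightarrow> ereal) \<Rightarrow> complex measure \<Rightarrow> complex measure \<Rightarrow> bool" where
  "is_complete_measure u \<mu> L \<longleftrightarrow>
     sets L = sets (restrict_space borel (cball 0 1)) \<and>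
     (\<exists>\<psi> C. represented_by u \<mu> \<psi> C \<and>
        (\<forall>M\<in>sets L. emeasure L M =
           (\<integral>\<^sup>+\<zeta>\<in>ball 0 1 \<inter> M. ennreal (1 - cmod \<zeta>) \<partial>\<mu>) + emeasure \<psi> (M \<inter> sphere 0 1)))"

(* is_Arg \<zeta> \<theta> holds for every value \<theta> of the argument, so the difference is taken modulo 2\<pi>. *)
definition carleson_box :: "real \<Rightarrow> real \<Rightarrow> complex set" where
  "carleson_box \<phi> \<delta> =
     {\<zeta> \<in> cball 0 1. cmod \<zeta> \<ge> 1 - \<delta> \<and> (\<exists>\<theta>. is_Arg \<zeta> \<theta> \<and> \<bar>\<theta> - \<phi>\<bar> \<le> pi * \<delta>)}"

definition box_mean :: "real \<Rightarrow> complex measure \<Rightarrow> real \<Rightarrow> real" where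
  "box_mean p L \<delta> =
     (LBINT \<phi>:{0..2*pi}. measure L (carleson_box \<phi> \<delta>) powr p) powr (1 / p)"

end

theory Submission
  imports Defs
begin

text \<open>
Up to the additive constant $C$, the function $-\log|f|$ is the potential
$V(z) = \int K(z,\zeta)\,d\lambda(\zeta)$ of the complete measure, whose kernel is the Green function
of the disc divided by $1-|\zeta|$ inside the disc and the Poisson kernel on the circle. Since
$\gamma \le 1$, the constant does not affect the growth condition for the means
(\<open>complete_measure_potential\<close>, \<open>m_mean_growth_iff\<close>). What has to be compared is the $L^p$ norm
of $V$ on the circle $|z| = 1-\delta$ and that of $\varphi \mapsto \lambda(\mathcal{C}(\varphi,\delta))$.

One direction is pointwise. For $z = (1-\delta)e^{i\varphi}$ the kernel is at least a constant times
$1/\delta$ on the whole box $\mathcal{C}(\varphi,\delta)$, because dividing by $1-|\zeta|$ compensates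
the decay of the Green function at the circle. So $\lambda(\mathcal{C}(\varphi,\delta)) \le 200\,\delta\,V(z)$
(\<open>potential_ge_carleson_box\<close>).

For the other direction $K$ is compared with the weight $W = \delta/(\delta+|z-\zeta|)^2$, which up to a
constant it exceeds only through the logarithmic pole at $\zeta = z$, and this pole is dominated by
$(\delta/|z-\zeta|)^{1/(2p)}$ (\<open>complete_kernel_le\<close>). Jensen's inequality with respect to
$W\,d\lambda$ bounds $V^p$ by $U^{p-1} \int W\,(K/W)^p\,d\lambda$, where $U = \int W\,d\lambda$. On an arc of
length $2\delta$ both $U$ and $W$ are constant up to a factor, and $(K/W)^p$ has a singularity of order
$1/2$ only, hence an integral of order $\delta$. So the integral of $V^p$ over such an arc is at most a
constant times $\delta\,U^p$ at its centre, and averaging over the centres gives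
$\|V\|_p \le c\,\|U\|_p$ (\<open>circle_potential_le\<close>). Finally $U$ is dominated by
$\sum_k 2^{-k} \cdot 4 s_k^{-1} \lambda(\{|\zeta-z| \le s_k\})$ with $s_k = 2^k\delta$. For
$s_k < 1/4$ the part of the ball in the closed disc lies in a Carleson box of size $2 s_k$, and for larger
$s_k$ the total mass is a sufficient bound. So under the box condition the $L^p$ norm of
$4 s_k^{-1} \lambda(\{|\zeta-z| \le s_k\})$ is of order $s_k^{\gamma-1} \le \delta^{\gamma-1}$, and the weights $2^{-k}$ make the sum converge
(\<open>circle_box_average_le\<close>).

The estimates hold for every finite measure on the closed disc and they also yield the finiteness of
$\int V^p$ on each circle near the boundary; in particular $|\log|f||^p$ is integrable there, so that
the Bochner integral in the definition of the mean is the true one.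
\<close>

section \<open>Powers of extended nonnegative reals and Jensen's inequality\<close>

lemma powr_pred_mult: "s powr ((\<gamma> - 1) * p) = s powr (\<gamma> * p) / s powr p" for s \<gamma> p :: real
  by (simp add: left_diff_distrib powr_diff)

text \<open>
The potential is infinite at the zeros of $f$, so its $p$-th power is taken in $[0,\infty]$. The real
power alone would send $\infty$ to $0$.
\<close>

definition ennpow :: "real \<Rightarrow> ennreal \<Rightarrow> ennreal" where
  "ennpow p x = (if x = top then top else ennreal (enn2real x powr p))"

lemma ennpow_ennreal: "0 \<le> a \<Longrightarrow> ennpow p (ennreal a) = ennreal (a powr p)"
  by (simp add: ennpow_def)

lemma ennpow_top [simp]: "ennpow p top = top"
  by (simp add: ennpow_def)

lemma ennpow_0 [simp]: "ennpow p 0 = 0"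
  by (simp add: ennpow_def)

lemma ennpow_mono:
  assumes "0 < p" "x \<le> y" shows "ennpow p x \<le> ennpow p y"
proof (cases "y = top")
  case False
  then have "x \<noteq> top" using assms(2) by (auto simp: top_unique)
  then show ?thesis using False assms
    by (auto simp: ennpow_def intro!: ennreal_leI powr_mono2 enn2real_mono simp: less_top)
qed simp

lemma ennpow_measurable [measurable]: "ennpow p \<in> borel_measurable borel"
  unfolding ennpow_def[abs_def] by measurable

lemma ennpow_mult:
  assumes "0 < p" "0 \<le> a"
  shows "ennpow p (ennreal a * x) = ennreal (a powr p) * ennpow p x"
proof (cases "a = 0")
  case False
  then have a: "a > 0" using assms by simp
  show ?thesis
  proof (cases x)
    case (real b)
    then show ?thesis using a
      by (simp add: ennpow_ennreal powr_mult flip: ennreal_mult)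
  next
    case top
    then show ?thesis using a
      by (simp add: ennreal_mult_top)
  qed
qed simp

lemma ennpow_mult_pred:
  assumes "1 < p" shows "ennpow (p - 1) x * x = ennpow p x"
proof (cases x)
  case (real b)
  have "b powr (p - 1) * b = b powr p"
    using real by (cases "b = 0") (simp_all add: powr_diff)
  then show ?thesis using real
    by (simp add: ennpow_ennreal flip: ennreal_mult)
next
  case top
  then show ?thesis by simp
qed

lemma ennpow_add_le:
  assumes "0 < p"
  shows "ennpow p (x + y) \<le> ennreal (2 powr p) * (ennpow p x + ennpow p y)"
proof -
  have "x + y \<le> ennreal 2 * max x y"
    by (metis add_mono ennreal_numeral max.cobounded1 max.cobounded2 mult_2 numeral_One zero_le_numeral)
  then have "ennpow p (x + y) \<le> ennreal (2 powr p) * ennpow p (max x y)"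
    using ennpow_mono[OF assms, of "x + y" "ennreal 2 * max x y"]
      ennpow_mult[OF assms, of 2 "max x y"] by simp
  also have "ennpow p (max x y) \<le> ennpow p x + ennpow p y"
    by (simp add: max_def)
  finally show ?thesis by (simp add: mult_left_mono)
qed

text \<open>
The graph of $a \mapsto a^p$ lies above its tangent at $c$. This is Young's inequality applied to
$a$ and $c^{p-1}$.
\<close>

lemma powr_tangent_line:
  fixes a c p :: real
  assumes "1 < p" "0 \<le> a" "0 < c"
  shows "p * c powr (p - 1) * a \<le> a powr p + (p - 1) * c powr p"
proof -
  define q where "q = p / (p - 1)"
  have q: "1 < q" "1 / p + 1 / q = 1"
    using assms by (auto simp: q_def field_simps)
  have "a * c powr (p - 1) \<le> a powr p / p + (c powr (p - 1)) powr q / q"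
    by (rule Youngs_inequality) (use assms q in auto)
  also have "(c powr (p - 1)) powr q = c powr p"
    using assms by (simp add: powr_powr q_def)
  finally have "p * (a * c powr (p - 1)) \<le> p * (a powr p / p + c powr p / q)"
    using assms by (intro mult_left_mono) auto
  also have "\<dots> = a powr p + (p - 1) * c powr p"
    using assms by (simp add: q_def field_simps)
  finally show ?thesis by (simp add: mult_ac)
qed

lemma ennpow_tangent_line:
  assumes "1 < p" "0 < c"
  shows "ennreal (p * c powr (p - 1)) * x \<le> ennpow p x + ennreal ((p - 1) * c powr p)"
proof (cases x)
  case (real a)
  then show ?thesis using powr_tangent_line[OF assms(1) _ assms(2), of a] assms
    by (simp add: ennpow_ennreal flip: ennreal_mult ennreal_plus)
qed simp

text \<open>
Integrating the tangent inequality at the mean value $c$ of $h$ gives $c^p\,N(X) \le \int h^p$, and this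
is the claim after multiplication by $N(X)^{p-1}$.
\<close>

lemma nn_integral_Jensen:
  assumes N: "finite_measure N" and p: "1 < p" and [measurable]: "h \<in> borel_measurable N"
  shows "ennpow p (\<integral>\<^sup>+x. h x \<partial>N)
    \<le> ennpow (p - 1) (emeasure N (space N)) * (\<integral>\<^sup>+x. ennpow p (h x) \<partial>N)"
proof -
  define m where "m = measure N (space N)"
  have m: "emeasure N (space N) = ennreal m" "0 \<le> m"
    using N by (simp_all add: m_def finite_measure.emeasure_eq_measure)
  define I where "I = (\<integral>\<^sup>+x. h x \<partial>N)"
  define J where "J = (\<integral>\<^sup>+x. ennpow p (h x) \<partial>N)"
  have tangent: "ennreal (p * c powr (p - 1)) * I \<le> J + ennreal ((p - 1) * c powr p) * ennreal m"
    if "0 < c" for c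
  proof -
    have "ennreal (p * c powr (p - 1)) * I = (\<integral>\<^sup>+x. ennreal (p * c powr (p - 1)) * h x \<partial>N)"
      by (simp add: I_def nn_integral_cmult)
    also have "\<dots> \<le> (\<integral>\<^sup>+x. ennpow p (h x) + ennreal ((p - 1) * c powr p) \<partial>N)"
      by (intro nn_integral_mono ennpow_tangent_line p that)
    also have "\<dots> = J + ennreal ((p - 1) * c powr p) * ennreal m"
      by (subst nn_integral_add) (auto simp: J_def m)
    finally show ?thesis .
  qed
  show ?thesis
  proof (cases "I = 0 \<or> m = 0")
    case True
    moreover have "I = 0" if "m = 0"
    proof -
      have "AE x in N. False"
        using that m by (intro AE_I'[of "space N"]) auto
      then have "AE x in N. h x = 0" by auto
      then show ?thesis by (simp add: I_def nn_integral_0_iff_AE)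
    qed
    ultimately show ?thesis by (auto simp: I_def[symmetric])
  next
    case False
    then have m0: "m > 0" and "I \<noteq> 0" using m by auto
    show ?thesis
    proof (cases "J = top")
      case True
      then show ?thesis using m0 by (simp add: J_def[symmetric] m ennpow_ennreal ennreal_mult_top)
    next
      case False
      then obtain j where j: "J = ennreal j" "0 \<le> j" by (cases J) auto
      have "I \<noteq> top"
      proof
        assume "I = top"
        then show False using tangent[of 1] p j m
          by (simp add: ennreal_mult_top top_unique ennreal_mult_less_top flip: ennreal_mult ennreal_plus)
      qed
      then obtain i where i: "I = ennreal i" "0 \<le> i" by (cases I) auto
      with \<open>I \<noteq> 0\<close> have i0: "i > 0" by (simp add: less_eq_real_def)
      \<comment> \<open>the mean value of \<open>h\<close>, at which the tangent inequality is sharp\<close>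
      define c where "c = i / m"
      have c: "c > 0" "i = c * m" using i0 m0 by (auto simp: c_def)
      have "p * c powr (p - 1) * i \<le> j + (p - 1) * c powr p * m"
        using tangent[OF c(1)] p i j m
        by (simp flip: ennreal_mult ennreal_plus)
      also have "p * c powr (p - 1) * i = p * c powr p * m"
        using c by (simp add: powr_diff)
      finally have "c powr p * m \<le> j" by (simp add: algebra_simps)
      then have "m powr (p - 1) * (c powr p * m) \<le> m powr (p - 1) * j"
        by (intro mult_left_mono) auto
      also have "m powr (p - 1) * (c powr p * m) = i powr p"
        using c m0 by (simp add: powr_mult powr_diff)
      finally show ?thesis
        by (simp add: I_def[symmetric] J_def[symmetric] i j m ennpow_ennreal flip: ennreal_mult)
    qed
  qed
qed

lemma ennpow_sum_Jensen:
  assumes "finite A" "1 < p" "\<And>k. k \<in> A \<Longrightarrow> 0 \<le> w k"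
  shows "ennpow p (\<Sum>k\<in>A. ennreal (w k) * y k)
    \<le> ennpow (p - 1) (ennreal (\<Sum>k\<in>A. w k)) * (\<Sum>k\<in>A. ennreal (w k) * ennpow p (y k))"
proof -
  let ?N = "point_measure A (\<lambda>k. ennreal (w k))"
  have "finite_measure ?N"
    by (intro finite_measureI) (simp add: space_point_measure emeasure_point_measure_finite assms(1))
  from nn_integral_Jensen[OF this assms(2), of y] show ?thesis
    using assms
    by (simp add: nn_integral_point_measure_finite space_point_measure emeasure_point_measure_finite sum_ennreal mult.commute)
qed

section \<open>A singular integral on the line\<close>

text \<open>
The integrand is given the value $\infty$ at the singularity so that it can dominate kernels that are
infinite there; a single point does not contribute to the integral.
\<close>

lemma nn_integral_inverse_sqrt_le:
  fixes a b c :: real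
  assumes "0 \<le> b" "0 \<le> c"
  shows "(\<integral>\<^sup>+t. (if t = a then top else ennreal ((c / \<bar>t - a\<bar>) powr (1/2))) * indicator {a-b..a+b} t \<partial>lborel)
    \<le> ennreal (4 * (b * c) powr (1/2))"
proof -
  have I0: "(\<integral>\<^sup>+t. ennreal (t powr (-1/2)) * indicator {0..b} t \<partial>lborel) = ennreal (2 * b powr (1/2))"
  proof -
    have "((\<lambda>x. x powr (-1/2)) has_integral (b powr (-1/2+1) / (-1/2+1))) {0..b}"
      by (rule has_integral_powr_from_0) (use assms in auto)
    then have *: "((\<lambda>x. x powr (-1/2)) has_integral (2 * b powr (1/2))) {0..b}" by (simp add: mult.commute)
    have "(\<integral>\<^sup>+t. ennreal (t powr (-1/2)) * indicator {0..b} t \<partial>lborel)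
        = (\<integral>\<^sup>+t. ennreal (indicator {0..b} t * t powr (-1/2)) \<partial>lborel)"
      by (intro nn_integral_cong) (simp add: indicator_def)
    also have "\<dots> = ennreal (2 * b powr (1/2))"
      using nn_integral_has_integral_lebesgue[OF _ *] by simp
    finally show ?thesis .
  qed
  have R: "(\<integral>\<^sup>+t. ennreal (\<bar>t - a\<bar> powr (-1/2)) * indicator {a..a+b} t \<partial>lborel) = ennreal (2 * b powr (1/2))"
    by (subst nn_integral_real_affine[where c=1 and t=a])
       (auto simp: I0[symmetric] indicator_def intro!: nn_integral_cong)
  have L: "(\<integral>\<^sup>+t. ennreal (\<bar>t - a\<bar> powr (-1/2)) * indicator {a-b..a} t \<partial>lborel) = ennreal (2 * b powr (1/2))"
    by (subst nn_integral_real_affine[where c="-1" and t=a])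
       (auto simp: I0[symmetric] indicator_def intro!: nn_integral_cong)
  have "(\<integral>\<^sup>+t. (if t = a then top else ennreal ((c / \<bar>t - a\<bar>) powr (1/2))) * indicator {a-b..a+b} t \<partial>lborel)
     \<le> (\<integral>\<^sup>+t. ennreal (c powr (1/2)) * (ennreal (\<bar>t - a\<bar> powr (-1/2)) * indicator {a..a+b} t
         + ennreal (\<bar>t - a\<bar> powr (-1/2)) * indicator {a-b..a} t) \<partial>lborel)"
  proof (rule nn_integral_mono_AE)
    have "AE t in lborel. t \<noteq> a" by (rule AE_lborel_singleton)
    then show "AE t in lborel. (if t = a then top else ennreal ((c / \<bar>t - a\<bar>) powr (1/2))) * indicator {a-b..a+b} t
      \<le> ennreal (c powr (1/2)) * (ennreal (\<bar>t - a\<bar> powr (-1/2)) * indicator {a..a+b} t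
         + ennreal (\<bar>t - a\<bar> powr (-1/2)) * indicator {a-b..a} t)"
    proof eventually_elim
      case (elim t)
      have "(c / \<bar>t - a\<bar>) powr (1/2) = c powr (1/2) * \<bar>t - a\<bar> powr (-1/2)"
        using assms elim by (simp add: powr_divide powr_minus divide_simps)
      then show ?case using elim assms
        by (auto simp: indicator_def simp flip: ennreal_mult)
    qed
  qed
  also have "\<dots> = ennreal (c powr (1/2)) * (ennreal (2 * b powr (1/2)) + ennreal (2 * b powr (1/2)))"
    by (subst nn_integral_cmult, simp, subst nn_integral_add) (simp_all only: L R, simp_all)
  also have "\<dots> = ennreal (4 * (b * c) powr (1/2))"
    using assms by (simp add: powr_mult flip: ennreal_mult ennreal_plus)
  finally show ?thesis .
qed

section \<open>The kernel of the complete measure\<close>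

text \<open>
The kernel against which the complete measure has to be integrated to recover the Green potential and
the Poisson integral together: the density $1-|\zeta|$ of the complete measure in the disc is divided
out, and the other case is meant for $|\zeta| = 1$.
\<close>

definition complete_kernel :: "complex \<Rightarrow> complex \<Rightarrow> ennreal" where
  "complete_kernel z \<zeta> =
     (if cmod \<zeta> < 1 then
        if z = \<zeta> then top
        else ennreal (ln (cmod (1 - z * cnj \<zeta>) / cmod (z - \<zeta>)) / (1 - cmod \<zeta>))
      else ennreal ((1 - (cmod z)\<^sup>2) / (2 * pi * (cmod (\<zeta> - z))\<^sup>2)))"

text \<open>
A Poisson-type kernel without a pole at $\zeta = z$. Up to constants it is
$\sum_{k \ge 0} 2^{-2k}\delta^{-1} 1_{B(z, 2^k\delta)}(\zeta)$, which ties its integral to the measure of Carleson boxes.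
\<close>

definition box_weight :: "real \<Rightarrow> complex \<Rightarrow> complex \<Rightarrow> real" where
  "box_weight \<delta> z \<zeta> = \<delta> / (\<delta> + cmod (z - \<zeta>))\<^sup>2"

lemma cmod_1_minus_mult_cnj_sq:
  "(cmod (1 - z * cnj \<zeta>))\<^sup>2 = (cmod (z - \<zeta>))\<^sup>2 + (1 - (cmod z)\<^sup>2) * (1 - (cmod \<zeta>)\<^sup>2)"
  unfolding cmod_power2 by (simp add: algebra_simps power2_eq_square)

text \<open>
In this form the Green function is a function of
$(1-|z|^2)(1-|\zeta|^2)/|z-\zeta|^2$ alone, and both estimates of the kernel reduce to
elementary inequalities for $\log(1+x)$.
\<close>

lemma ln_green_eq:
  assumes "cmod z < 1" "cmod \<zeta> < 1" "z \<noteq> \<zeta>"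
  shows "ln (cmod (1 - z * cnj \<zeta>) / cmod (z - \<zeta>))
    = ln (1 + (1 - (cmod z)\<^sup>2) * (1 - (cmod \<zeta>)\<^sup>2) / (cmod (z - \<zeta>))\<^sup>2) / 2"
proof -
  have d: "cmod (z - \<zeta>) > 0" using assms by simp
  have "cmod (z * cnj \<zeta>) < 1"
    using assms mult_strict_mono'[of "cmod z" 1 "cmod \<zeta>" 1] by (simp add: norm_mult)
  then have "z * cnj \<zeta> \<noteq> 1" by auto
  then have n: "cmod (1 - z * cnj \<zeta>) > 0" by simp
  have "1 + (1 - (cmod z)\<^sup>2) * (1 - (cmod \<zeta>)\<^sup>2) / (cmod (z - \<zeta>))\<^sup>2
      = (cmod (1 - z * cnj \<zeta>) / cmod (z - \<zeta>))\<^sup>2"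
    using d by (simp add: power_divide cmod_1_minus_mult_cnj_sq field_simps)
  then show ?thesis using n d by (simp add: ln_realpow)
qed

text \<open>
With $x$ the quantity in the logarithm, $x \ge (1-|\zeta|)/(25\delta)$, and this lower bound $y$ is at most
$1$, where $\log(1+y) \ge y/2$. The factor $1-|\zeta|$ then cancels.
\<close>

lemma complete_kernel_ge:
  assumes "0 < \<delta>" "\<delta> < 1" "cmod z = 1 - \<delta>" "cmod \<zeta> \<le> 1" "1 - \<delta> \<le> cmod \<zeta>"
    and d: "cmod (z - \<zeta>) \<le> 5 * \<delta>"
  shows "ennreal (1 / (200 * \<delta>)) \<le> complete_kernel z \<zeta>"
proof (cases "z = \<zeta>")
  case True
  then show ?thesis using assms by (simp add: complete_kernel_def)
next
  case False
  define e where "e = cmod (z - \<zeta>)"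
  have e: "0 < e" "e\<^sup>2 \<le> 25 * \<delta>\<^sup>2"
    using False d power_mono[of e "5 * \<delta>" 2] by (auto simp: e_def power_mult_distrib)
  have z1: "\<delta> \<le> 1 - (cmod z)\<^sup>2"
    unfolding assms(3) using assms(1,2) mult_left_mono[of \<delta> 1 \<delta>] by (simp add: power2_eq_square algebra_simps)
  show ?thesis
  proof (cases "cmod \<zeta> < 1")
    case True
    define t where "t = 1 - cmod \<zeta>"
    have t: "0 < t" "t \<le> \<delta>" using True assms by (auto simp: t_def)
    have z2: "t \<le> 1 - (cmod \<zeta>)\<^sup>2"
      using True mult_right_mono[of "cmod \<zeta>" 1 "cmod \<zeta>"] by (simp add: t_def power2_eq_square)
    define y where "y = t / (25 * \<delta>)"
    have y: "0 < y" "y \<le> 1" using t assms by (auto simp: y_def field_simps)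
    have "y = \<delta> * t / (25 * \<delta>\<^sup>2)" using assms by (simp add: y_def power2_eq_square)
    also have "\<dots> \<le> (1 - (cmod z)\<^sup>2) * (1 - (cmod \<zeta>)\<^sup>2) / e\<^sup>2"
      using e z1 z2 t assms by (intro frac_le mult_mono) auto
    finally have yx: "y \<le> (1 - (cmod z)\<^sup>2) * (1 - (cmod \<zeta>)\<^sup>2) / e\<^sup>2" .
    have "y / 2 \<le> y / (1 + y)" using y by (simp add: field_simps)
    also have "\<dots> = 1 - 1 / (1 + y)" using y by (simp add: field_simps)
    also have "\<dots> \<le> ln (1 + y)"
      using ln_le_minus_one[of "1 / (1 + y)"] y by (simp add: ln_div)
    also have "\<dots> \<le> ln (1 + (1 - (cmod z)\<^sup>2) * (1 - (cmod \<zeta>)\<^sup>2) / e\<^sup>2)"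
      using y yx by simp
    finally have "y / 4 \<le> ln (cmod (1 - z * cnj \<zeta>) / cmod (z - \<zeta>))"
      using False assms True by (subst ln_green_eq) (auto simp: e_def)
    then have "(y / 4) / t \<le> ln (cmod (1 - z * cnj \<zeta>) / cmod (z - \<zeta>)) / t"
      using t by (intro divide_right_mono) auto
    moreover have "1 / (200 * \<delta>) \<le> (y / 4) / t"
      using t assms by (simp add: y_def field_simps)
    ultimately show ?thesis using True False
      by (auto simp: complete_kernel_def t_def intro!: ennreal_leI)
  next
    case b: False
    have "1 / (200 * \<delta>) = \<delta> / (2 * 4 * (25 * \<delta>\<^sup>2))" using assms by (simp add: power2_eq_square)
    also have "\<dots> \<le> (1 - (cmod z)\<^sup>2) / (2 * pi * e\<^sup>2)"
      using z1 e assms pi_less_4 by (intro frac_le mult_mono) auto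
    finally show ?thesis using b
      by (auto simp: complete_kernel_def e_def norm_minus_commute intro!: ennreal_leI)
  qed
qed

text \<open>
Away from $z$, for $|z-\zeta| \ge \delta/2$, the bound $\log(1+x) \le x$ suffices. Near $z$ the distance
$1-|\zeta|$ is comparable with $\delta$, and the logarithm of $\delta/|z-\zeta|$ that remains is traded for a
small power. The exponent $1/(2p)$ is chosen so that the $p$-th power of the bound is still integrable
along a circle.
\<close>

lemma complete_kernel_le:
  assumes "0 < \<delta>" "\<delta> \<le> 1/2" "cmod z = 1 - \<delta>" "cmod \<zeta> \<le> 1" "1 < p"
  shows "complete_kernel z \<zeta> \<le> ennreal (box_weight \<delta> z \<zeta>) *
    (if z = \<zeta> then top else ennreal (18 * (1 + 2 * p) * (1 + (\<delta> / cmod (z - \<zeta>)) powr (1 / (2 * p)))))"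
proof (cases "z = \<zeta>")
  case True
  then show ?thesis using assms by (auto simp: box_weight_def ennreal_mult_top)
next
  case False
  define d where "d = cmod (z - \<zeta>)"
  define t where "t = 1 - cmod \<zeta>"
  define g where "g = (\<delta> / d) powr (1 / (2 * p))"
  define W where "W = box_weight \<delta> z \<zeta>"
  have d: "d > 0" using False by (simp add: d_def)
  have g0: "g \<ge> 0" by (simp add: g_def)
  have W0: "W > 0" using assms d by (simp add: W_def box_weight_def d_def[symmetric])
  have td: "\<bar>t - \<delta>\<bar> \<le> d"
    using norm_triangle_ineq3[of z \<zeta>] assms by (simp add: t_def d_def)
  have z1: "1 - (cmod z)\<^sup>2 \<le> 2 * \<delta>" "0 \<le> 1 - (cmod z)\<^sup>2"
    unfolding assms(3) using assms(1,2) mult_left_mono[of \<delta> 1 \<delta>] by (auto simp: power2_eq_square algebra_simps)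
  have z2: "1 - (cmod \<zeta>)\<^sup>2 \<le> 2 * t" "0 \<le> 1 - (cmod \<zeta>)\<^sup>2"
  proof -
    have "1 - (cmod \<zeta>)\<^sup>2 = 2 * t - t\<^sup>2" by (simp add: t_def power2_eq_square algebra_simps)
    then show "1 - (cmod \<zeta>)\<^sup>2 \<le> 2 * t" by simp
    show "0 \<le> 1 - (cmod \<zeta>)\<^sup>2" using power_mono[of "cmod \<zeta>" 1 2] assms by simp
  qed
  have far: "2 * \<delta> / d\<^sup>2 \<le> 18 * W" if "\<delta> / 2 \<le> d"
  proof -
    have "(\<delta> + d)\<^sup>2 \<le> (3 * d)\<^sup>2" using that assms by (intro power_mono) auto
    then have "18 * (\<delta> / (3 * d)\<^sup>2) \<le> 18 * (\<delta> / (\<delta> + d)\<^sup>2)"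
      using assms d by (intro mult_left_mono divide_left_mono mult_pos_pos) auto
    then show ?thesis by (simp add: W_def box_weight_def d_def power_mult_distrib)
  qed
  have absorb: "18 * W \<le> W * (18 * (1 + 2 * p) * (1 + g))"
  proof -
    have "1 * 1 \<le> (1 + 2 * p) * (1 + g)" using assms g0 by (intro mult_mono) auto
    then have "(18 * W) * 1 \<le> (18 * W) * ((1 + 2 * p) * (1 + g))"
      using W0 by (intro mult_left_mono) auto
    then show ?thesis by (simp only: mult_ac mult_1)
  qed
  show ?thesis
  proof (cases "cmod \<zeta> < 1")
    case True
    have t: "t > 0" using True by (simp add: t_def)
    define x where "x = (1 - (cmod z)\<^sup>2) * (1 - (cmod \<zeta>)\<^sup>2) / d\<^sup>2"
    have x0: "0 \<le> x" using z1 z2 by (simp add: x_def)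
    have "x \<le> (2 * \<delta>) * (2 * t) / d\<^sup>2"
      unfolding x_def using z1 z2 assms by (intro divide_right_mono mult_mono) auto
    then have x: "x \<le> 4 * \<delta> * t / d\<^sup>2" by simp
    have "ln (1 + x) / 2 / t \<le> W * (18 * (1 + 2 * p) * (1 + g))"
    proof (cases "\<delta> / 2 \<le> d")
      case True
      have "ln (1 + x) / 2 / t \<le> (4 * \<delta> * t / d\<^sup>2) / 2 / t"
        using ln_add_one_self_le_self[OF x0] x t by (intro divide_right_mono) auto
      also have "\<dots> = 2 * \<delta> / d\<^sup>2" using t by simp
      finally show ?thesis using far[OF True] absorb by linarith
    next
      case False
      have t2: "t \<ge> \<delta> / 2" "t \<le> 3 / 2 * \<delta>" using False td by auto
      define y where "y = \<delta> / d"
      have y: "y \<ge> 1" using False d assms by (simp add: y_def field_simps)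
      have "x \<le> 4 * \<delta> * (3 / 2 * \<delta>) / d\<^sup>2"
        by (rule order_trans[OF x divide_right_mono[OF mult_left_mono[OF t2(2)]]]) (use assms in auto)
      also have "\<dots> = 6 * y\<^sup>2" by (simp add: y_def power_divide power2_eq_square)
      finally have "1 + x \<le> 7 * y\<^sup>2" using y one_le_power[of y 2] by linarith
      then have "ln (1 + x) \<le> ln (7 * y\<^sup>2)" using x0 y by simp
      also have "\<dots> = ln 7 + 2 * ln y" using y by (simp add: ln_mult ln_realpow)
      finally have l1: "ln (1 + x) / 2 \<le> ln 7 / 2 + ln y" by simp
      have "ln (7::real) \<le> ln (exp 1 ^ 2)"
      proof -
        have "(2.7::real) \<le> exp 1" using e_approx_32 by (simp add: abs_if split: if_splits)
        then have "(2.7::real)^2 \<le> exp 1 ^ 2" by (intro power_mono) auto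
        then show ?thesis by (simp add: power2_eq_square)
      qed
      then have l7: "ln (7::real) \<le> 2" by (simp add: ln_realpow)
      have ly: "ln y \<le> 2 * p * g"
      proof -
        have "ln (y powr (1 / (2 * p))) \<le> y powr (1 / (2 * p)) - 1"
          using y by (intro ln_le_minus_one) auto
        then have "ln y / (2 * p) \<le> g" using y by (simp add: ln_powr g_def y_def)
        then show ?thesis using assms by (simp add: field_simps)
      qed
      have "ln (1 + x) / 2 \<le> 1 + 2 * p * g" using l1 l7 ly by simp
      also have "\<dots> \<le> (1 + 2 * p) * (1 + g)" using assms g0 by (simp add: algebra_simps)
      finally have l: "ln (1 + x) / 2 \<le> (1 + 2 * p) * (1 + g)" .
      have "ln (1 + x) / 2 / t \<le> (1 + 2 * p) * (1 + g) / (\<delta> / 2)"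
        using l t2 assms g0 x0 by (intro frac_le) auto
      also have "\<dots> = (2 / \<delta>) * ((1 + 2 * p) * (1 + g))" by simp
      also have "\<dots> \<le> (18 * W) * ((1 + 2 * p) * (1 + g))"
      proof (rule mult_right_mono)
        have "(\<delta> + d)\<^sup>2 \<le> (3 * \<delta>)\<^sup>2" using False d assms by (intro power_mono) auto
        then have "18 * (\<delta> / (3 * \<delta>)\<^sup>2) \<le> 18 * (\<delta> / (\<delta> + d)\<^sup>2)"
          using assms d by (intro mult_left_mono divide_left_mono mult_pos_pos) auto
        then have "18 * (\<delta> / (3 * \<delta>)\<^sup>2) \<le> 18 * W"
          by (simp add: W_def box_weight_def d_def)
        moreover have "18 * (\<delta> / (3 * \<delta>)\<^sup>2) = 2 / \<delta>"
          using assms by (simp add: power2_eq_square)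
        ultimately show "2 / \<delta> \<le> 18 * W" by simp
      qed (use assms g0 in auto)
      finally show ?thesis by (simp add: mult_ac)
    qed
    then show ?thesis using False True assms W0
      by (auto simp: complete_kernel_def ln_green_eq x_def d_def t_def g_def W_def
          simp flip: ennreal_mult' intro!: ennreal_leI)
  next
    case b: False
    then have "t = 0" using assms by (simp add: t_def)
    then have "\<delta> \<le> d" using td by simp
    have "(1 - (cmod z)\<^sup>2) / (2 * pi * d\<^sup>2) \<le> (2 * \<delta>) / (1 * d\<^sup>2)"
      using z1 d assms pi_gt3 by (intro frac_le mult_mono) auto
    also have "\<dots> \<le> W * (18 * (1 + 2 * p) * (1 + g))" using far \<open>\<delta> \<le> d\<close> absorb assms by simp
    finally show ?thesis using False b W0
      by (auto simp: complete_kernel_def d_def g_def W_def norm_minus_commute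
          simp flip: ennreal_mult' intro!: ennreal_leI)
  qed
qed

section \<open>Circles and Carleson boxes\<close>

lemma cmod_circle_diff:
  assumes "0 \<le> r"
  shows "cmod (of_real r * cis s - of_real r * cis t) = r * (2 * \<bar>sin ((s - t) / 2)\<bar>)"
proof -
  have "of_real r * cis s - of_real r * cis t = of_real r * cis t * (exp (\<i> * of_real (s - t)) - 1)"
  proof -
    have "exp (\<i> * of_real (s - t)) = cis (s - t)" by (simp add: cis_conv_exp)
    moreover have "cis t * cis (s - t) = cis s" by (simp add: cis_mult)
    ultimately show ?thesis by (simp only: right_diff_distrib mult_1_right mult.assoc)
  qed
  then show ?thesis using assms by (simp only: norm_mult dist_exp_i_1) simp
qed

lemma circle_diff_le:
  assumes "0 \<le> r" "r \<le> 1"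
  shows "cmod (of_real r * cis s - of_real r * cis t) \<le> \<bar>s - t\<bar>"
proof -
  have "2 * \<bar>sin ((s - t) / 2)\<bar> \<le> \<bar>s - t\<bar>" using abs_sin_x_le_abs_x[of "(s - t) / 2"] by simp
  then have "r * (2 * \<bar>sin ((s - t) / 2)\<bar>) \<le> 1 * \<bar>s - t\<bar>" using assms by (intro mult_mono) auto
  then show ?thesis by (simp add: cmod_circle_diff assms)
qed

text \<open>
The cosine is at least $1/2$ on $[0,1]$ because $1 \le \pi/3$.
\<close>

lemma abs_sin_ge_half:
  fixes x :: real assumes "\<bar>x\<bar> \<le> 1" shows "\<bar>x\<bar> / 2 \<le> \<bar>sin x\<bar>"
proof -
  have pos: "y / 2 \<le> sin y" if "0 < y" "y \<le> 1" for y :: real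
  proof -
    have "\<exists>u>0. u < y \<and> sin y - sin 0 = (y - 0) * cos u"
      by (rule MVT2) (use that in auto)
    then obtain u where u: "0 < u" "u < y" "sin y - sin 0 = (y - 0) * cos u" by blast
    have "cos (pi / 3) \<le> cos u"
      using u that pi_gt3 by (intro cos_monotone_0_pi_le) auto
    then have "1 / 2 \<le> cos u" by (simp add: cos_60)
    then show ?thesis using u that mult_left_mono[of "1/2" "cos u" y] by simp
  qed
  show ?thesis
    using pos[of x] pos[of "-x"] assms by (cases "x > 0"; cases "x = 0") auto
qed

lemma circle_diff_ge:
  assumes "1 / 2 \<le> r" "\<bar>s - t\<bar> \<le> 2"
  shows "\<bar>s - t\<bar> / 4 \<le> cmod (of_real r * cis s - of_real r * cis t)"
proof -
  have "\<bar>s - t\<bar> / 2 \<le> 2 * \<bar>sin ((s - t) / 2)\<bar>" using abs_sin_ge_half[of "(s - t) / 2"] assms by simp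
  then have "1 / 2 * (\<bar>s - t\<bar> / 2) \<le> r * (2 * \<bar>sin ((s - t) / 2)\<bar>)"
    using assms by (intro mult_mono) auto
  then show ?thesis using assms by (simp add: cmod_circle_diff)
qed

text \<open>
The bound is uniform in $\zeta$. If $a$ is the parameter of the point of the arc closest to $\zeta$, then
$|z_\theta - z_a| \le 2|z_\theta - \zeta|$, so the distance to $\zeta$ is at least a multiple of
$|\theta - a|$, wherever $\zeta$ lies.
\<close>

lemma nn_integral_inverse_sqrt_dist_circle_le:
  assumes "0 < \<delta>" "\<delta> \<le> 1/2"
  defines "z \<equiv> \<lambda>\<theta>. of_real (1 - \<delta>) * cis \<theta>"
  shows "(\<integral>\<^sup>+\<theta>. (if z \<theta> = \<zeta> then top else ennreal (1 + (\<delta> / cmod (z \<theta> - \<zeta>)) powr (1/2)))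
      * indicator {\<phi>-\<delta>..\<phi>+\<delta>} \<theta> \<partial>lborel) \<le> ennreal (18 * \<delta>)"
proof -
  have "\<exists>a\<in>{\<phi>-\<delta>..\<phi>+\<delta>}. \<forall>\<theta>\<in>{\<phi>-\<delta>..\<phi>+\<delta>}. cmod (z a - \<zeta>) \<le> cmod (z \<theta> - \<zeta>)"
    using assms by (intro continuous_attains_inf) (auto simp: z_def intro!: continuous_intros)
  then obtain a where a: "a \<in> {\<phi>-\<delta>..\<phi>+\<delta>}"
    and amin: "\<And>\<theta>. \<theta> \<in> {\<phi>-\<delta>..\<phi>+\<delta>} \<Longrightarrow> cmod (z a - \<zeta>) \<le> cmod (z \<theta> - \<zeta>)" by blast
  have low: "\<bar>\<theta> - a\<bar> / 8 \<le> cmod (z \<theta> - \<zeta>)" if "\<theta> \<in> {\<phi>-\<delta>..\<phi>+\<delta>}" for \<theta>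
  proof -
    have "\<bar>\<theta> - a\<bar> / 4 \<le> cmod (z \<theta> - z a)"
      unfolding z_def using a that assms by (intro circle_diff_ge) auto
    also have "\<dots> \<le> cmod (z \<theta> - \<zeta>) + cmod (z a - \<zeta>)"
      using norm_triangle_ineq4[of "z \<theta> - \<zeta>" "z a - \<zeta>"] by simp
    also have "\<dots> \<le> 2 * cmod (z \<theta> - \<zeta>)" using amin[OF that] by simp
    finally show ?thesis by simp
  qed
  have "(\<integral>\<^sup>+\<theta>. (if z \<theta> = \<zeta> then top else ennreal (1 + (\<delta> / cmod (z \<theta> - \<zeta>)) powr (1/2)))
      * indicator {\<phi>-\<delta>..\<phi>+\<delta>} \<theta> \<partial>lborel)
    \<le> (\<integral>\<^sup>+\<theta>. indicator {\<phi>-\<delta>..\<phi>+\<delta>} \<theta>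
      + (if \<theta> = a then top else ennreal ((8 * \<delta> / \<bar>\<theta> - a\<bar>) powr (1/2))) * indicator {a-2*\<delta>..a+2*\<delta>} \<theta> \<partial>lborel)"
  proof (rule nn_integral_mono)
    fix \<theta> :: real
    show "(if z \<theta> = \<zeta> then top else ennreal (1 + (\<delta> / cmod (z \<theta> - \<zeta>)) powr (1/2)))
        * indicator {\<phi>-\<delta>..\<phi>+\<delta>} \<theta>
      \<le> indicator {\<phi>-\<delta>..\<phi>+\<delta>} \<theta>
      + (if \<theta> = a then top else ennreal ((8 * \<delta> / \<bar>\<theta> - a\<bar>) powr (1/2))) * indicator {a-2*\<delta>..a+2*\<delta>} \<theta>"
    proof (cases "\<theta> \<in> {\<phi>-\<delta>..\<phi>+\<delta>}")
      case True
      then have ind: "\<theta> \<in> {a-2*\<delta>..a+2*\<delta>}" using a by auto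
      show ?thesis
      proof (cases "\<theta> = a")
        case True
        then show ?thesis using ind by simp
      next
        case False
        have pos: "0 < cmod (z \<theta> - \<zeta>)"
          by (rule less_le_trans[OF _ low[OF True]]) (use False in simp)
        have "\<delta> / cmod (z \<theta> - \<zeta>) \<le> \<delta> / (\<bar>\<theta> - a\<bar> / 8)"
          using low[OF True] False pos assms by (intro divide_left_mono) auto
        then have "(\<delta> / cmod (z \<theta> - \<zeta>)) powr (1/2) \<le> (8 * \<delta> / \<bar>\<theta> - a\<bar>) powr (1/2)"
          using assms by (intro powr_mono2) (auto simp: mult.commute)
        then have "ennreal (1 + (\<delta> / cmod (z \<theta> - \<zeta>)) powr (1/2))
            \<le> 1 + ennreal ((8 * \<delta> / \<bar>\<theta> - a\<bar>) powr (1/2))"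
          by (simp add: ennreal_leI add_left_mono)
        then show ?thesis using True ind False pos by auto
      qed
    qed simp
  qed
  also have "\<dots> = (\<integral>\<^sup>+\<theta>. indicator {\<phi>-\<delta>..\<phi>+\<delta>} \<theta> \<partial>lborel)
      + (\<integral>\<^sup>+\<theta>. (if \<theta> = a then top else ennreal ((8 * \<delta> / \<bar>\<theta> - a\<bar>) powr (1/2))) * indicator {a-2*\<delta>..a+2*\<delta>} \<theta> \<partial>lborel)"
    by (intro nn_integral_add) auto
  also have "\<dots> \<le> ennreal (2 * \<delta>) + ennreal (4 * (2 * \<delta> * (8 * \<delta>)) powr (1/2))"
    using assms by (intro add_mono nn_integral_inverse_sqrt_le) auto
  also have "(2 * \<delta> * (8 * \<delta>)) powr (1/2) = 4 * \<delta>"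
  proof -
    have "2 * \<delta> * (8 * \<delta>) = (4 * \<delta>) ^ 2" by (simp add: power2_eq_square)
    moreover have "((4 * \<delta>) ^ 2) powr (1/2) = sqrt ((4 * \<delta>) ^ 2)"
      by (rule powr_half_sqrt) simp
    moreover have "sqrt ((4 * \<delta>) ^ 2) = 4 * \<delta>"
      using assms(1) by (intro real_sqrt_unique) auto
    ultimately show ?thesis by simp
  qed
  also have "ennreal (2 * \<delta>) + ennreal (4 * (4 * \<delta>)) = ennreal (18 * \<delta>)"
    using assms by (simp flip: ennreal_plus)
  finally show ?thesis .
qed

text \<open>
Every box is a rotation of one closed polar rectangle. This makes it a closed set, and it makes
membership jointly measurable in the angle and the point.
\<close>

lemma carleson_box_altdef:
  assumes "\<delta> < 1"
  shows "carleson_box \<phi> \<delta> =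
    {\<zeta>. \<zeta> * cis (-\<phi>) \<in> (\<lambda>(\<rho>, \<tau>). of_real \<rho> * cis \<tau>) ` ({1-\<delta>..1} \<times> {-(pi*\<delta>)..pi*\<delta>})}" (is "_ = ?R")
proof (intro set_eqI iffI)
  fix \<zeta> assume "\<zeta> \<in> carleson_box \<phi> \<delta>"
  then obtain \<theta> where *: "cmod \<zeta> \<le> 1" "1 - \<delta> \<le> cmod \<zeta>" "is_Arg \<zeta> \<theta>" "\<bar>\<theta> - \<phi>\<bar> \<le> pi * \<delta>"
    by (auto simp: carleson_box_def)
  then have "\<zeta> = of_real (cmod \<zeta>) * cis \<theta>" by (simp add: is_Arg_def cis_conv_exp)
  then have "\<zeta> * cis (-\<phi>) = of_real (cmod \<zeta>) * (cis \<theta> * cis (-\<phi>))"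
    by (metis mult.assoc)
  then have "\<zeta> * cis (-\<phi>) = of_real (cmod \<zeta>) * cis (\<theta> - \<phi>)"
    by (simp add: cis_mult)
  then show "\<zeta> \<in> ?R" using * by (auto intro!: image_eqI[of _ _ "(cmod \<zeta>, \<theta> - \<phi>)"])
next
  fix \<zeta> assume "\<zeta> \<in> ?R"
  then obtain \<rho> \<tau> where "\<rho> \<in> {1-\<delta>..1}" "\<tau> \<in> {-(pi*\<delta>)..pi*\<delta>}"
    and "\<zeta> * cis (-\<phi>) = of_real \<rho> * cis \<tau>" by auto
  then have *: "1 - \<delta> \<le> \<rho>" "\<rho> \<le> 1" "\<bar>\<tau>\<bar> \<le> pi * \<delta>" "\<zeta> * cis (-\<phi>) = of_real \<rho> * cis \<tau>"
    by (auto simp: abs_le_iff)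
  have "\<zeta> = \<zeta> * cis (-\<phi>) * cis \<phi>" by (simp add: mult.assoc cis_mult)
  also have "\<dots> = of_real \<rho> * cis (\<tau> + \<phi>)" unfolding *(4) by (simp add: cis_mult mult.assoc)
  finally have \<zeta>: "\<zeta> = of_real \<rho> * cis (\<tau> + \<phi>)" .
  then have "cmod \<zeta> = \<rho>" using * assms by (simp add: norm_mult)
  then show "\<zeta> \<in> carleson_box \<phi> \<delta>" using * \<zeta>
    by (auto simp: carleson_box_def is_Arg_def cis_conv_exp intro!: exI[of _ "\<tau> + \<phi>"])
qed

lemma closed_carleson_sector:
  "closed ((\<lambda>(\<rho>, \<tau>). complex_of_real \<rho> * cis \<tau>) ` ({a..b} \<times> {c..d}))"
  by (intro compact_imp_closed compact_continuous_image compact_Times)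
     (auto simp: case_prod_beta intro!: continuous_intros)

lemma carleson_box_measurable_pair:
  assumes "\<delta> < 1"
  shows "{x. snd x \<in> carleson_box (fst x) \<delta>} \<in> sets (borel \<Otimes>\<^sub>M borel)"
proof -
  have "(\<lambda>x. snd x * cis (- fst x)) \<in> borel_measurable (borel \<Otimes>\<^sub>M borel :: (real \<times> complex) measure)"
    unfolding borel_prod by (intro borel_measurable_continuous_onI continuous_intros)
  from measurable_sets[OF this borel_closed[OF closed_carleson_sector]]
  show ?thesis
    by (simp add: carleson_box_altdef[OF assms] vimage_def space_pair_measure)
qed

lemma carleson_box_borel:
  assumes "\<delta> < 1" shows "carleson_box \<phi> \<delta> \<in> sets borel"
proof -
  have "(\<lambda>\<zeta>. \<zeta> * cis (- \<phi>)) \<in> borel_measurable (borel :: complex measure)"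
    by (intro borel_measurable_continuous_onI continuous_intros)
  from measurable_sets[OF this borel_closed[OF closed_carleson_sector]]
  show ?thesis by (simp add: carleson_box_altdef[OF assms] vimage_def)
qed

lemma carleson_box_dist_le:
  assumes "0 < \<delta>" "\<delta> < 1" "\<zeta> \<in> carleson_box \<phi> \<delta>"
  shows "cmod (of_real (1 - \<delta>) * cis \<phi> - \<zeta>) \<le> 5 * \<delta>"
proof -
  obtain \<theta> where *: "cmod \<zeta> \<le> 1" "1 - \<delta> \<le> cmod \<zeta>" "is_Arg \<zeta> \<theta>" "\<bar>\<theta> - \<phi>\<bar> \<le> pi * \<delta>"
    using assms(3) by (auto simp: carleson_box_def)
  then have \<zeta>: "\<zeta> = of_real (cmod \<zeta>) * cis \<theta>" by (simp add: is_Arg_def cis_conv_exp)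
  have "cmod (of_real (1 - \<delta>) * cis \<phi> - \<zeta>)
    \<le> cmod (of_real (1 - \<delta>) * cis \<phi> - of_real (1 - \<delta>) * cis \<theta>) + cmod (of_real (1 - \<delta>) * cis \<theta> - \<zeta>)"
    using dist_triangle[of "of_real (1 - \<delta>) * cis \<phi>" \<zeta> "of_real (1 - \<delta>) * cis \<theta>"] unfolding dist_norm .
  also have "of_real (1 - \<delta>) * cis \<theta> - \<zeta> = of_real (1 - \<delta> - cmod \<zeta>) * cis \<theta>"
    by (subst \<zeta>) (simp add: algebra_simps)
  also have "cmod \<dots> \<le> \<delta>" using * assms by (simp add: norm_mult del: of_real_diff)
  also have "cmod (of_real (1 - \<delta>) * cis \<phi> - of_real (1 - \<delta>) * cis \<theta>) \<le> 4 * \<delta>"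
  proof -
    have "cmod (of_real (1 - \<delta>) * cis \<phi> - of_real (1 - \<delta>) * cis \<theta>) \<le> \<bar>\<phi> - \<theta>\<bar>"
      using assms by (intro circle_diff_le) auto
    also have "\<dots> \<le> pi * \<delta>" using *(4) by (simp add: abs_minus_commute)
    also have "\<dots> \<le> 4 * \<delta>" using assms pi_less_4 by (intro mult_right_mono) auto
    finally show ?thesis .
  qed
  finally show ?thesis by simp
qed

text \<open>
After rotation by $-\theta$ a point $w$ of the ball has real part at least $1/2$ and imaginary part at
most $s$ in modulus, so $|\arg w| \le 2s$.
\<close>

lemma cball_subset_carleson_box:
  assumes "0 < \<delta>" "\<delta> \<le> s" "s < 1/4"
  shows "cball (of_real (1 - \<delta>) * cis \<theta>) s \<inter> cball 0 1 \<subseteq> carleson_box \<theta> (2 * s)"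
proof
  fix \<zeta> assume "\<zeta> \<in> cball (of_real (1 - \<delta>) * cis \<theta>) s \<inter> cball 0 1"
  then have d: "cmod (\<zeta> - of_real (1 - \<delta>) * cis \<theta>) \<le> s" and n: "cmod \<zeta> \<le> 1"
    by (auto simp: dist_norm norm_minus_commute)
  define w where "w = \<zeta> * cis (-\<theta>)"
  have "w - of_real (1 - \<delta>) = (\<zeta> - of_real (1 - \<delta>) * cis \<theta>) * cis (-\<theta>)"
    by (simp add: w_def algebra_simps cis_mult)
  then have w: "cmod (w - of_real (1 - \<delta>)) \<le> s" using d by (simp add: norm_mult)
  have re: "\<bar>Re w - (1 - \<delta>)\<bar> \<le> s" and im: "\<bar>Im w\<bar> \<le> s"
    using abs_Re_le_cmod[of "w - of_real (1 - \<delta>)"] abs_Im_le_cmod[of "w - of_real (1 - \<delta>)"] w by auto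
  have re2: "Re w \<ge> 1/2" "Re w \<ge> 1 - 2 * s" using re assms by auto
  have cw: "cmod w = cmod \<zeta>" by (simp add: w_def norm_mult)
  have "\<bar>Arg w\<bar> = \<bar>arctan (Im w / Re w)\<bar>" using re2 by (subst arg_conv_arctan) auto
  also have "\<dots> \<le> \<bar>Im w / Re w\<bar>" by (rule abs_arctan_le)
  also have "\<dots> \<le> s / (1/2)" unfolding abs_divide using re2 im by (intro frac_le) auto
  also have "\<dots> \<le> pi * (2 * s)" using assms pi_gt3 mult_right_mono[of 1 pi "2 * s"] by simp
  finally have arg: "\<bar>Arg w\<bar> \<le> pi * (2 * s)" .
  have "w = of_real (cmod w) * cis (Arg w)" by (metis rcis_cmod_Arg rcis_def)
  moreover have "1 - 2 * s \<le> cmod w" using re2 abs_Re_le_cmod[of w] by linarith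
  ultimately show "\<zeta> \<in> carleson_box \<theta> (2 * s)"
    using arg cw n assms
    by (subst carleson_box_altdef) (auto simp: w_def[symmetric] abs_le_iff intro!: image_eqI[of _ _ "(cmod w, Arg w)"])
qed

section \<open>Averages over arcs and measurability\<close>

lemma cis_measurable [measurable]: "cis \<in> borel_measurable borel"
  by (intro borel_measurable_continuous_onI continuous_intros)

lemma complete_kernel_measurable [measurable (raw)]:
  assumes [measurable]: "f \<in> borel_measurable N" "g \<in> borel_measurable N"
  shows "(\<lambda>x. complete_kernel (f x) (g x)) \<in> borel_measurable N"
proof -
  have [measurable]: "cnj \<in> borel_measurable borel"
    by (intro borel_measurable_continuous_onI continuous_intros)
  \<comment> \<open>equality of points is rewritten as the vanishing of a measurable real function\<close>
  have *: "complete_kernel z \<zeta> =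
     (if cmod \<zeta> < 1 then
        if cmod (z - \<zeta>) = 0 then top
        else ennreal (ln (cmod (1 - z * cnj \<zeta>) / cmod (z - \<zeta>)) / (1 - cmod \<zeta>))
      else ennreal ((1 - (cmod z)\<^sup>2) / (2 * pi * (cmod (\<zeta> - z))\<^sup>2)))" for z \<zeta>
    by (simp add: complete_kernel_def)
  show ?thesis unfolding * by measurable
qed

lemma box_weight_measurable [measurable (raw)]:
  assumes [measurable]: "f \<in> borel_measurable N" "g \<in> borel_measurable N"
  shows "(\<lambda>x. box_weight \<delta> (f x) (g x)) \<in> borel_measurable N"
  unfolding box_weight_def by measurable

text \<open>
Every $\theta \in [0,2\pi]$ has a set of measure at least $\delta$ of points $\varphi \in [0,2\pi]$ with
$|\varphi - \theta| \le \delta$, so $F$ is bounded by its average over these $\varphi$, and Tonelli's theorem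
exchanges the two variables.
\<close>

lemma window_average_le:
  fixes F G :: "real \<Rightarrow> ennreal"
  assumes [measurable]: "F \<in> borel_measurable borel" "G \<in> borel_measurable borel"
    and "0 < \<delta>" "\<delta> \<le> pi"
    and window: "\<And>\<phi>. (\<integral>\<^sup>+\<theta>. F \<theta> * indicator {\<phi>-\<delta>..\<phi>+\<delta>} \<theta> \<partial>lborel) \<le> ennreal (c * \<delta>) * G \<phi>"
    and "0 \<le> c"
  shows "(\<integral>\<^sup>+\<theta>\<in>{0..2*pi}. F \<theta> \<partial>lborel) \<le> ennreal c * (\<integral>\<^sup>+\<phi>\<in>{0..2*pi}. G \<phi> \<partial>lborel)"
proof -
  define J where "J = (\<lambda>\<theta> \<phi>. F \<theta> * indicator {\<phi>-\<delta>..\<phi>+\<delta>} \<theta> * indicator {0..2*pi} \<phi>)"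
  have [measurable]: "(\<lambda>x. J (fst x) (snd x)) \<in> borel_measurable (borel \<Otimes>\<^sub>M borel)"
  proof -
    have "J \<theta> \<phi> = (if \<bar>\<theta> - \<phi>\<bar> \<le> \<delta> \<and> \<phi> \<in> {0..2*pi} then F \<theta> else 0)" for \<theta> \<phi>
      by (auto simp: J_def indicator_def abs_le_iff)
    then show ?thesis by simp
  qed
  have low: "ennreal \<delta> * (F \<theta> * indicator {0..2*pi} \<theta>) \<le> (\<integral>\<^sup>+\<phi>. J \<theta> \<phi> \<partial>lborel)" for \<theta>
  proof (cases "\<theta> \<in> {0..2*pi}")
    case True
    \<comment> \<open>a window of length \<open>\<delta>\<close> beginning or ending at \<open>\<theta>\<close> that stays inside the period\<close>
    define b where "b = (if \<theta> \<le> pi then \<theta> else \<theta> - \<delta>)"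
    have "ennreal \<delta> * (F \<theta> * indicator {0..2*pi} \<theta>) = (\<integral>\<^sup>+\<phi>. F \<theta> * indicator {b..b+\<delta>} \<phi> \<partial>lborel)"
      using True assms(3) by (simp add: nn_integral_cmult mult.commute)
    also have "\<dots> \<le> (\<integral>\<^sup>+\<phi>. J \<theta> \<phi> \<partial>lborel)"
      using True assms(3,4) by (intro nn_integral_mono) (auto simp: J_def b_def indicator_def)
    finally show ?thesis .
  qed simp
  have "ennreal \<delta> * (\<integral>\<^sup>+\<theta>\<in>{0..2*pi}. F \<theta> \<partial>lborel) = (\<integral>\<^sup>+\<theta>. ennreal \<delta> * (F \<theta> * indicator {0..2*pi} \<theta>) \<partial>lborel)"
    by (simp add: nn_integral_cmult)
  also have "\<dots> \<le> (\<integral>\<^sup>+\<theta>. \<integral>\<^sup>+\<phi>. J \<theta> \<phi> \<partial>lborel \<partial>lborel)"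
    by (intro nn_integral_mono low)
  also have "\<dots> = (\<integral>\<^sup>+\<phi>. \<integral>\<^sup>+\<theta>. J \<theta> \<phi> \<partial>lborel \<partial>lborel)"
    by (intro lborel_pair.Fubini'[symmetric]) (simp add: case_prod_beta)
  also have "\<dots> \<le> (\<integral>\<^sup>+\<phi>. ennreal \<delta> * (ennreal c * (G \<phi> * indicator {0..2*pi} \<phi>)) \<partial>lborel)"
  proof (rule nn_integral_mono)
    fix \<phi> :: real
    have "(\<integral>\<^sup>+\<theta>. J \<theta> \<phi> \<partial>lborel) = (\<integral>\<^sup>+\<theta>. F \<theta> * indicator {\<phi>-\<delta>..\<phi>+\<delta>} \<theta> \<partial>lborel) * indicator {0..2*pi} \<phi>"
      unfolding J_def by (rule nn_integral_multc) simp
    also have "\<dots> \<le> ennreal (c * \<delta>) * G \<phi> * indicator {0..2*pi} \<phi>"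
      by (intro mult_right_mono window) simp
    finally show "(\<integral>\<^sup>+\<theta>. J \<theta> \<phi> \<partial>lborel) \<le> ennreal \<delta> * (ennreal c * (G \<phi> * indicator {0..2*pi} \<phi>))"
      using assms(3,6) by (simp add: ennreal_mult mult_ac)
  qed
  also have "\<dots> = ennreal \<delta> * (ennreal c * (\<integral>\<^sup>+\<phi>\<in>{0..2*pi}. G \<phi> \<partial>lborel))"
    by (simp add: nn_integral_cmult)
  finally show ?thesis
    using assms(3) by (subst (asm) ennreal_mult_le_mult_iff) auto
qed

section \<open>Upper estimate of the potential\<close>

definition potential :: "complex measure \<Rightarrow> complex \<Rightarrow> ennreal" where
  "potential M z = (\<integral>\<^sup>+\<zeta>. complete_kernel z \<zeta> \<partial>M)"

definition box_average :: "complex measure \<Rightarrow> real \<Rightarrow> complex \<Rightarrow> ennreal" where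
  "box_average M \<delta> z = (\<integral>\<^sup>+\<zeta>. ennreal (box_weight \<delta> z \<zeta>) \<partial>M)"

text \<open>
A Harnack inequality: the weight changes at most by a constant factor when its pole moves by $\delta$.
\<close>

lemma box_weight_Harnack:
  assumes "0 < \<delta>" "cmod (z - w) \<le> \<delta>"
  shows "ennreal (box_weight \<delta> z \<zeta>) \<le> ennreal 4 * ennreal (box_weight \<delta> w \<zeta>)"
proof -
  have "cmod (w - \<zeta>) \<le> cmod (z - w) + cmod (z - \<zeta>)"
    using norm_triangle_ineq4[of "z - \<zeta>" "z - w"] by simp
  then have "\<delta> + cmod (w - \<zeta>) \<le> 2 * (\<delta> + cmod (z - \<zeta>))" using assms(2) norm_ge_zero[of "z - \<zeta>"]
    unfolding distrib_left by linarith
  then have "(\<delta> + cmod (w - \<zeta>))\<^sup>2 \<le> (2 * (\<delta> + cmod (z - \<zeta>)))\<^sup>2"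
    using assms by (intro power_mono) auto
  then have "4 * (\<delta> / (2 * (\<delta> + cmod (z - \<zeta>)))\<^sup>2) \<le> 4 * (\<delta> / (\<delta> + cmod (w - \<zeta>))\<^sup>2)"
    using assms by (intro mult_left_mono divide_left_mono mult_pos_pos zero_less_power) (auto intro: add_pos_nonneg)
  also have "4 * (\<delta> / (2 * (\<delta> + cmod (z - \<zeta>)))\<^sup>2) = box_weight \<delta> z \<zeta>"
    unfolding power_mult_distrib box_weight_def by simp
  finally have "ennreal (box_weight \<delta> z \<zeta>) \<le> ennreal (4 * box_weight \<delta> w \<zeta>)"
    unfolding box_weight_def by (rule ennreal_leI)
  also have "\<dots> = ennreal 4 * ennreal (box_weight \<delta> w \<zeta>)"
    by (rule ennreal_mult') simp
  finally show ?thesis .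
qed

text \<open>
Complete measures live on the closed disc. Regarding them as Borel measures on the whole plane that are
concentrated there keeps all measurability questions within the Borel sets of the plane.
\<close>

locale disc_measure = finite_measure M for M :: "complex measure" +
  assumes sets_M [measurable_cong]: "sets M = sets borel"
    and AE_M: "AE \<zeta> in M. cmod \<zeta> \<le> 1"
begin

lemma potential_measurable [measurable]: "potential M \<in> borel_measurable borel"
  unfolding potential_def[abs_def] by measurable

lemma box_average_measurable [measurable]: "box_average M \<delta> \<in> borel_measurable borel"
  unfolding box_average_def[abs_def] by measurable

lemma box_average_Harnack:
  assumes "0 < \<delta>" "cmod (z - w) \<le> \<delta>"
  shows "box_average M \<delta> z \<le> ennreal 4 * box_average M \<delta> w"
proof -
  have "box_average M \<delta> z \<le> (\<integral>\<^sup>+\<zeta>. ennreal 4 * ennreal (box_weight \<delta> w \<zeta>) \<partial>M)"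
    unfolding box_average_def by (intro nn_integral_mono box_weight_Harnack assms)
  then show ?thesis by (simp add: box_average_def nn_integral_cmult)
qed

lemma box_average_le:
  assumes "0 < \<delta>"
  shows "box_average M \<delta> z \<le> ennreal (measure M (space M) / \<delta>)"
proof -
  have "box_weight \<delta> z \<zeta> \<le> 1 / \<delta>" for \<zeta>
  proof -
    have "\<delta> / (\<delta> + cmod (z - \<zeta>))\<^sup>2 \<le> \<delta> / \<delta>\<^sup>2"
      using assms by (intro divide_left_mono power_mono mult_pos_pos zero_less_power) (auto intro: add_pos_nonneg)
    then show ?thesis using assms by (simp add: box_weight_def power2_eq_square)
  qed
  then have "box_average M \<delta> z \<le> (\<integral>\<^sup>+\<zeta>. ennreal (1 / \<delta>) \<partial>M)"
    unfolding box_average_def by (intro nn_integral_mono ennreal_leI)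
  also have "\<dots> = ennreal (measure M (space M) / \<delta>)"
    using assms by (simp add: emeasure_eq_measure flip: ennreal_mult)
  finally show ?thesis .
qed

text \<open>
Jensen's inequality with respect to $W\,d\lambda$ for the quotient of the kernel by $W$. Raising the bound of
this quotient to the power $p$ turns the exponent $1/(2p)$ into $1/2$.
\<close>

lemma ennpow_potential_le:
  fixes p \<delta> :: real
  assumes "0 < \<delta>" "\<delta> \<le> 1/2" "1 < p" "cmod z = 1 - \<delta>"
  shows "ennpow p (potential M z) \<le> ennpow (p - 1) (box_average M \<delta> z) *
    (\<integral>\<^sup>+\<zeta>. ennreal (box_weight \<delta> z \<zeta>) * (ennreal ((36 * (1 + 2 * p)) powr p) *
      (if z = \<zeta> then top else ennreal (1 + (\<delta> / cmod (z - \<zeta>)) powr (1/2)))) \<partial>M)"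
proof -
  define h where "h = (\<lambda>\<zeta>. if cmod (z - \<zeta>) = 0 then top else
    ennreal (18 * (1 + 2 * p) * (1 + (\<delta> / cmod (z - \<zeta>)) powr (1 / (2 * p)))))"
  have [measurable]: "h \<in> borel_measurable borel" unfolding h_def by measurable
  define N where "N = density M (\<lambda>\<zeta>. ennreal (box_weight \<delta> z \<zeta>))"
  have N: "emeasure N (space N) = box_average M \<delta> z"
    by (simp add: N_def emeasure_density box_average_def cong: nn_integral_cong)
  have fin: "finite_measure N"
    using box_average_le[OF assms(1), of z] by (intro finite_measureI) (auto simp: N top_unique)
  have "potential M z \<le> (\<integral>\<^sup>+\<zeta>. ennreal (box_weight \<delta> z \<zeta>) * h \<zeta> \<partial>M)"
    unfolding potential_def
  proof (rule nn_integral_mono_AE)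
    show "AE \<zeta> in M. complete_kernel z \<zeta> \<le> ennreal (box_weight \<delta> z \<zeta>) * h \<zeta>"
      using AE_M
    proof eventually_elim
      case (elim \<zeta>)
      then show ?case using complete_kernel_le[OF assms(1,2,4) elim assms(3)] by (simp add: h_def)
    qed
  qed
  also have "\<dots> = (\<integral>\<^sup>+\<zeta>. h \<zeta> \<partial>N)" by (simp add: N_def nn_integral_density)
  finally have "ennpow p (potential M z) \<le> ennpow p (\<integral>\<^sup>+\<zeta>. h \<zeta> \<partial>N)"
    using assms by (intro ennpow_mono) auto
  also have "\<dots> \<le> ennpow (p - 1) (box_average M \<delta> z) * (\<integral>\<^sup>+\<zeta>. ennpow p (h \<zeta>) \<partial>N)"
    using nn_integral_Jensen[OF fin assms(3), of h] by (simp add: N) (simp add: N_def)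
  also have "(\<integral>\<^sup>+\<zeta>. ennpow p (h \<zeta>) \<partial>N) = (\<integral>\<^sup>+\<zeta>. ennreal (box_weight \<delta> z \<zeta>) * ennpow p (h \<zeta>) \<partial>M)"
    by (simp add: N_def nn_integral_density)
  also have "\<dots> \<le> (\<integral>\<^sup>+\<zeta>. ennreal (box_weight \<delta> z \<zeta>) * (ennreal ((36 * (1 + 2 * p)) powr p) *
      (if z = \<zeta> then top else ennreal (1 + (\<delta> / cmod (z - \<zeta>)) powr (1/2)))) \<partial>M)"
  proof (intro nn_integral_mono mult_left_mono)
    fix \<zeta>
    show "ennpow p (h \<zeta>) \<le> ennreal ((36 * (1 + 2 * p)) powr p) *
      (if z = \<zeta> then top else ennreal (1 + (\<delta> / cmod (z - \<zeta>)) powr (1/2)))"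
    proof (cases "z = \<zeta>")
      case True
      then show ?thesis using assms by (simp add: ennreal_mult_top)
    next
      case False
      define g where "g = (\<delta> / cmod (z - \<zeta>)) powr (1 / (2 * p))"
      have g: "g \<ge> 0" by (simp add: g_def)
      have gp: "g powr p = (\<delta> / cmod (z - \<zeta>)) powr (1/2)"
        using assms by (simp add: g_def powr_powr)
      have h: "h \<zeta> = ennreal (18 * (1 + 2 * p)) * (1 + ennreal g)"
      proof -
        have "h \<zeta> = ennreal (18 * (1 + 2 * p) * (1 + g))"
          using False by (simp add: h_def g_def)
        also have "\<dots> = ennreal (18 * (1 + 2 * p)) * ennreal (1 + g)"
          using assms(3) by (intro ennreal_mult') simp
        also have "ennreal (1 + g) = 1 + ennreal g" using g by simp
        finally show ?thesis .
      qed
      have "ennpow p (h \<zeta>) = ennreal ((18 * (1 + 2 * p)) powr p) * ennpow p (1 + ennreal g)"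
        unfolding h by (rule ennpow_mult) (use assms(3) in auto)
      also have "\<dots> \<le> ennreal ((18 * (1 + 2 * p)) powr p) * (ennreal (2 powr p) * (ennpow p 1 + ennpow p (ennreal g)))"
        using assms by (intro mult_left_mono ennpow_add_le) auto
      also have "ennpow p 1 = 1" using ennpow_ennreal[of 1 p] by simp
      also have "1 + ennpow p (ennreal g) = ennreal (1 + (\<delta> / cmod (z - \<zeta>)) powr (1/2))"
        using g by (simp add: ennpow_ennreal gp)
      also have "ennreal ((18 * (1 + 2 * p)) powr p) * (ennreal (2 powr p) * ennreal (1 + (\<delta> / cmod (z - \<zeta>)) powr (1/2)))
        = ennreal ((36 * (1 + 2 * p)) powr p) * ennreal (1 + (\<delta> / cmod (z - \<zeta>)) powr (1/2))"
      proof -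
        have "(36 * (1 + 2 * p)) powr p = (18 * (1 + 2 * p)) powr p * 2 powr p"
          using assms by (simp flip: powr_mult)
        then show ?thesis by (simp only: ennreal_mult'[OF powr_ge_zero] mult.assoc)
      qed
      finally show ?thesis using False by simp
    qed
  qed simp
  finally show ?thesis by (simp add: mult_left_mono)
qed

text \<open>
On the arc around $\varphi$ the factors $U^{p-1}$ and $W$ are replaced by their values at $\varphi$, and what
is left depends on $\theta$ through the singular factor alone. Its integral over the arc is of order
$\delta$ for every $\zeta$, so Tonelli's theorem leaves $\delta\,U^{p-1} \int W\,d\lambda = \delta\,U^p$.
\<close>

lemma window_potential_le:
  fixes p \<delta> :: real
  assumes "0 < \<delta>" "\<delta> \<le> 1/2" "1 < p"
  defines "z \<equiv> \<lambda>\<theta>. of_real (1 - \<delta>) * cis \<theta>"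
  shows "(\<integral>\<^sup>+\<theta>. ennpow p (potential M (z \<theta>)) * indicator {\<phi>-\<delta>..\<phi>+\<delta>} \<theta> \<partial>lborel)
    \<le> ennreal (18 * (144 * (1 + 2 * p)) powr p * \<delta>) * ennpow p (box_average M \<delta> (z \<phi>))"
proof -
  have sf: "sigma_finite_measure M" ..
  interpret pair_sigma_finite lborel M ..
  define A where "A = (36 * (1 + 2 * p)) powr p"
  define H where "H = (\<lambda>\<theta> \<zeta>. if z \<theta> = \<zeta> then top else ennreal (1 + (\<delta> / cmod (z \<theta> - \<zeta>)) powr (1/2)))"
  have [measurable]: "z \<in> borel_measurable borel" unfolding z_def by measurable
  have [measurable]: "(\<lambda>x. H (fst x) (snd x)) \<in> borel_measurable (lborel \<Otimes>\<^sub>M M)"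
  proof -
    have "H \<theta> \<zeta> = (if cmod (z \<theta> - \<zeta>) = 0 then top else ennreal (1 + (\<delta> / cmod (z \<theta> - \<zeta>)) powr (1/2)))" for \<theta> \<zeta>
      by (simp add: H_def)
    then show ?thesis by simp
  qed
  define B where "B = ennpow (p - 1) (box_average M \<delta> (z \<phi>))"
  define W where "W = (\<lambda>\<zeta>. ennreal (box_weight \<delta> (z \<phi>) \<zeta>))"
  have [measurable]: "W \<in> borel_measurable borel" unfolding W_def by measurable
  have pw: "ennpow p (potential M (z \<theta>)) * indicator {\<phi>-\<delta>..\<phi>+\<delta>} \<theta>
    \<le> ennreal (4 powr p * A) * B * (\<integral>\<^sup>+\<zeta>. W \<zeta> * (H \<theta> \<zeta> * indicator {\<phi>-\<delta>..\<phi>+\<delta>} \<theta>) \<partial>M)" for \<theta>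
  proof (cases "\<theta> \<in> {\<phi>-\<delta>..\<phi>+\<delta>}")
    case True
    have "cmod (z \<theta> - z \<phi>) \<le> \<bar>\<theta> - \<phi>\<bar>"
      unfolding z_def using assms(1,2) by (intro circle_diff_le) auto
    then have d: "cmod (z \<theta> - z \<phi>) \<le> \<delta>" using True by auto
    have "cmod (z \<theta>) = 1 - \<delta>" using assms(1,2) by (simp add: z_def norm_mult del: of_real_diff)
    note ennpow_potential_le[OF assms(1-3) this]
    also have "ennpow (p - 1) (box_average M \<delta> (z \<theta>)) \<le> ennpow (p - 1) (ennreal 4 * box_average M \<delta> (z \<phi>))"
      using assms(3) by (intro ennpow_mono box_average_Harnack assms(1) d) auto
    also have "\<dots> = ennreal (4 powr (p - 1)) * B"
      unfolding B_def using assms(3) by (intro ennpow_mult) auto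
    also have "(\<integral>\<^sup>+\<zeta>. ennreal (box_weight \<delta> (z \<theta>) \<zeta>) * (ennreal ((36 * (1 + 2 * p)) powr p) *
      (if z \<theta> = \<zeta> then top else ennreal (1 + (\<delta> / cmod (z \<theta> - \<zeta>)) powr (1/2)))) \<partial>M)
      \<le> (\<integral>\<^sup>+\<zeta>. ennreal (4 * A) * (W \<zeta> * H \<theta> \<zeta>) \<partial>M)"
    proof (rule nn_integral_mono)
      fix \<zeta>
      have "ennreal (box_weight \<delta> (z \<theta>) \<zeta>) \<le> ennreal 4 * W \<zeta>"
        unfolding W_def by (rule box_weight_Harnack[OF assms(1) d])
      then have "ennreal (box_weight \<delta> (z \<theta>) \<zeta>) * (ennreal A * H \<theta> \<zeta>) \<le> ennreal 4 * W \<zeta> * (ennreal A * H \<theta> \<zeta>)"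
        by (intro mult_right_mono) auto
      also have "\<dots> = ennreal (4 * A) * (W \<zeta> * H \<theta> \<zeta>)"
        by (simp add: ennreal_mult A_def mult_ac)
      finally show "ennreal (box_weight \<delta> (z \<theta>) \<zeta>) * (ennreal ((36 * (1 + 2 * p)) powr p) *
        (if z \<theta> = \<zeta> then top else ennreal (1 + (\<delta> / cmod (z \<theta> - \<zeta>)) powr (1/2))))
        \<le> ennreal (4 * A) * (W \<zeta> * H \<theta> \<zeta>)" by (simp only: A_def H_def)
    qed
    also have "\<dots> = ennreal (4 * A) * (\<integral>\<^sup>+\<zeta>. W \<zeta> * H \<theta> \<zeta> \<partial>M)"
    proof (rule nn_integral_cmult)
      have "H \<theta> \<in> borel_measurable M"
        using measurable_Pair2[of "\<lambda>x. H (fst x) (snd x)" lborel M borel \<theta>] by simp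
      then show "(\<lambda>\<zeta>. W \<zeta> * H \<theta> \<zeta>) \<in> borel_measurable M" by measurable
    qed
    also have "ennreal (4 powr (p - 1)) * B * (ennreal (4 * A) * (\<integral>\<^sup>+\<zeta>. W \<zeta> * H \<theta> \<zeta> \<partial>M))
      = ennreal (4 powr (p - 1) * (4 * A)) * B * (\<integral>\<^sup>+\<zeta>. W \<zeta> * H \<theta> \<zeta> \<partial>M)"
      by (simp add: ennreal_mult A_def mult_ac)
    also have "4 powr (p - 1) * (4 * A) = 4 powr p * A" by (simp add: powr_diff)
    finally show ?thesis using True by (simp add: mult_left_mono mult_right_mono)
  qed simp
  have "(\<integral>\<^sup>+\<theta>. ennpow p (potential M (z \<theta>)) * indicator {\<phi>-\<delta>..\<phi>+\<delta>} \<theta> \<partial>lborel)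
    \<le> (\<integral>\<^sup>+\<theta>. ennreal (4 powr p * A) * B * (\<integral>\<^sup>+\<zeta>. W \<zeta> * (H \<theta> \<zeta> * indicator {\<phi>-\<delta>..\<phi>+\<delta>} \<theta>) \<partial>M) \<partial>lborel)"
    by (intro nn_integral_mono pw)
  also have "\<dots> = ennreal (4 powr p * A) * B * (\<integral>\<^sup>+\<theta>. \<integral>\<^sup>+\<zeta>. W \<zeta> * (H \<theta> \<zeta> * indicator {\<phi>-\<delta>..\<phi>+\<delta>} \<theta>) \<partial>M \<partial>lborel)"
  proof (rule nn_integral_cmult)
    show "(\<lambda>\<theta>. \<integral>\<^sup>+\<zeta>. W \<zeta> * (H \<theta> \<zeta> * indicator {\<phi>-\<delta>..\<phi>+\<delta>} \<theta>) \<partial>M) \<in> borel_measurable lborel"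
      by (rule sigma_finite_measure.borel_measurable_nn_integral[OF sf]) (simp add: case_prod_beta)
  qed
  also have "(\<integral>\<^sup>+\<theta>. \<integral>\<^sup>+\<zeta>. W \<zeta> * (H \<theta> \<zeta> * indicator {\<phi>-\<delta>..\<phi>+\<delta>} \<theta>) \<partial>M \<partial>lborel)
    = (\<integral>\<^sup>+\<zeta>. \<integral>\<^sup>+\<theta>. W \<zeta> * (H \<theta> \<zeta> * indicator {\<phi>-\<delta>..\<phi>+\<delta>} \<theta>) \<partial>lborel \<partial>M)"
    by (intro Fubini'[symmetric]) (simp add: case_prod_beta)
  also have "\<dots> \<le> (\<integral>\<^sup>+\<zeta>. W \<zeta> * ennreal (18 * \<delta>) \<partial>M)"
  proof (rule nn_integral_mono)
    fix \<zeta> assume \<zeta>: "\<zeta> \<in> space M"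
    have [measurable]: "(\<lambda>\<theta>. H \<theta> \<zeta>) \<in> borel_measurable borel"
      using measurable_Pair1[of "\<lambda>x. H (fst x) (snd x)" lborel M borel \<zeta>] \<zeta> by simp
    have "(\<integral>\<^sup>+\<theta>. W \<zeta> * (H \<theta> \<zeta> * indicator {\<phi>-\<delta>..\<phi>+\<delta>} \<theta>) \<partial>lborel)
      = W \<zeta> * (\<integral>\<^sup>+\<theta>. H \<theta> \<zeta> * indicator {\<phi>-\<delta>..\<phi>+\<delta>} \<theta> \<partial>lborel)"
      by (intro nn_integral_cmult) simp
    also have "\<dots> \<le> W \<zeta> * ennreal (18 * \<delta>)"
      unfolding H_def z_def by (intro mult_left_mono nn_integral_inverse_sqrt_dist_circle_le assms) auto
    finally show "(\<integral>\<^sup>+\<theta>. W \<zeta> * (H \<theta> \<zeta> * indicator {\<phi>-\<delta>..\<phi>+\<delta>} \<theta>) \<partial>lborel) \<le> W \<zeta> * ennreal (18 * \<delta>)" .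
  qed
  also have "\<dots> = box_average M \<delta> (z \<phi>) * ennreal (18 * \<delta>)"
    by (simp add: nn_integral_multc W_def box_average_def)
  finally have "(\<integral>\<^sup>+\<theta>. ennpow p (potential M (z \<theta>)) * indicator {\<phi>-\<delta>..\<phi>+\<delta>} \<theta> \<partial>lborel)
    \<le> ennreal (4 powr p * A) * B * (box_average M \<delta> (z \<phi>) * ennreal (18 * \<delta>))"
    by (simp add: mult_left_mono)
  also have "\<dots> = ennreal (18 * \<delta>) * ennreal (4 powr p * A) * (B * box_average M \<delta> (z \<phi>))"
    by (simp only: mult_ac)
  also have "B * box_average M \<delta> (z \<phi>) = ennpow p (box_average M \<delta> (z \<phi>))"
    unfolding B_def by (rule ennpow_mult_pred[OF assms(3)])
  also have "ennreal (18 * \<delta>) * ennreal (4 powr p * A) = ennreal (18 * \<delta> * (4 powr p * A))"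
    using assms(1) by (simp add: ennreal_mult A_def)
  also have "18 * \<delta> * (4 powr p * A) = 18 * (144 * (1 + 2 * p)) powr p * \<delta>"
    unfolding A_def using assms(3) by (simp flip: powr_mult)
  finally show ?thesis .
qed

lemma circle_potential_le:
  fixes p \<delta> :: real
  assumes "0 < \<delta>" "\<delta> \<le> 1/2" "1 < p"
  shows "(\<integral>\<^sup>+\<theta>\<in>{0..2*pi}. ennpow p (potential M (of_real (1 - \<delta>) * cis \<theta>)) \<partial>lborel)
    \<le> ennreal (18 * (144 * (1 + 2 * p)) powr p) *
      (\<integral>\<^sup>+\<theta>\<in>{0..2*pi}. ennpow p (box_average M \<delta> (of_real (1 - \<delta>) * cis \<theta>)) \<partial>lborel)"
proof (rule window_average_le[where \<delta>=\<delta>])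
  show "\<delta> \<le> pi" using assms pi_gt3 by simp
qed (use assms window_potential_le in auto)

end

section \<open>Comparison with balls and boxes\<close>

text \<open>
The term that dominates is the one for the least $k$ with $|z-\zeta| \le 2^k\delta$. For $k > 0$ the
distance exceeds $2^{k-1}\delta$.
\<close>

lemma box_weight_dyadic_le:
  assumes "0 < \<delta>" "cmod (z - \<zeta>) \<le> 2 ^ N * \<delta>"
  shows "box_weight \<delta> z \<zeta> \<le> (\<Sum>k\<le>N. (1/2) ^ k * (4 / (2 ^ k * \<delta>) * indicator (cball z (2 ^ k * \<delta>)) \<zeta>))"
proof -
  define k where "k = (LEAST k. cmod (z - \<zeta>) \<le> 2 ^ k * \<delta>)"
  have k: "cmod (z - \<zeta>) \<le> 2 ^ k * \<delta>" unfolding k_def by (rule LeastI[of _ N]) (rule assms(2))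
  have kN: "k \<le> N" unfolding k_def by (rule Least_le) (rule assms(2))
  have "box_weight \<delta> z \<zeta> \<le> (1/2) ^ k * (4 / (2 ^ k * \<delta>))"
  proof (cases k)
    case 0
    have "\<delta> / (\<delta> + cmod (z - \<zeta>))\<^sup>2 \<le> \<delta> / \<delta>\<^sup>2"
      using assms by (intro divide_left_mono power_mono mult_pos_pos zero_less_power) (auto intro: add_pos_nonneg)
    also have "\<dots> = 1 / \<delta>" by (simp add: power2_eq_square)
    also have "\<dots> \<le> 4 / \<delta>" using assms(1) by (intro divide_right_mono) auto
    finally show ?thesis using 0 by (simp add: box_weight_def)
  next
    case (Suc j)
    have "\<not> cmod (z - \<zeta>) \<le> 2 ^ j * \<delta>"
      using not_less_Least[of j "\<lambda>k. cmod (z - \<zeta>) \<le> 2 ^ k * \<delta>"] Suc by (simp add: k_def)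
    then have "2 ^ j * \<delta> \<le> \<delta> + cmod (z - \<zeta>)" using assms(1) by simp
    then have "\<delta> / (\<delta> + cmod (z - \<zeta>))\<^sup>2 \<le> \<delta> / (2 ^ j * \<delta>)\<^sup>2"
      using assms(1) by (intro divide_left_mono power_mono mult_pos_pos zero_less_power) (auto intro: add_pos_nonneg)
    also have "\<dots> = (1/2) ^ k * (4 / (2 ^ k * \<delta>))"
      using assms(1) by (simp add: Suc power2_eq_square field_simps)
    finally show ?thesis by (simp add: box_weight_def)
  qed
  also have "\<dots> = (1/2) ^ k * (4 / (2 ^ k * \<delta>) * indicator (cball z (2 ^ k * \<delta>)) \<zeta>)"
    using k by (simp add: dist_norm)
  also have "\<dots> \<le> (\<Sum>k\<le>N. (1/2) ^ k * (4 / (2 ^ k * \<delta>) * indicator (cball z (2 ^ k * \<delta>)) \<zeta>))"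
    by (rule member_le_sum) (use kN assms(1) in auto)
  finally show ?thesis .
qed

context disc_measure
begin

lemma box_average_dyadic_le:
  assumes "0 < \<delta>" "cmod z \<le> 1" "2 \<le> 2 ^ N * \<delta>"
  shows "box_average M \<delta> z \<le>
    (\<Sum>k\<le>N. ennreal ((1/2) ^ k) * ennreal (4 / (2 ^ k * \<delta>) * measure M (cball z (2 ^ k * \<delta>))))"
proof -
  have "box_average M \<delta> z \<le> (\<integral>\<^sup>+\<zeta>. (\<Sum>k\<le>N. ennreal ((1/2) ^ k * (4 / (2 ^ k * \<delta>))) * indicator (cball z (2 ^ k * \<delta>)) \<zeta>) \<partial>M)"
    unfolding box_average_def
  proof (rule nn_integral_mono_AE)
    show "AE \<zeta> in M. ennreal (box_weight \<delta> z \<zeta>)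
      \<le> (\<Sum>k\<le>N. ennreal ((1/2) ^ k * (4 / (2 ^ k * \<delta>))) * indicator (cball z (2 ^ k * \<delta>)) \<zeta>)"
      using AE_M
    proof eventually_elim
      case (elim \<zeta>)
      have "cmod (z - \<zeta>) \<le> 2 ^ N * \<delta>"
        using norm_triangle_ineq4[of z \<zeta>] elim assms by linarith
      from ennreal_leI[OF box_weight_dyadic_le[OF assms(1) this]]
      have "ennreal (box_weight \<delta> z \<zeta>)
        \<le> (\<Sum>k\<le>N. ennreal ((1/2) ^ k * (4 / (2 ^ k * \<delta>) * indicator (cball z (2 ^ k * \<delta>)) \<zeta>)))"
        using assms(1) by (subst sum_ennreal) auto
      also have "\<dots> = (\<Sum>k\<le>N. ennreal ((1/2) ^ k * (4 / (2 ^ k * \<delta>))) * indicator (cball z (2 ^ k * \<delta>)) \<zeta>)"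
        by (intro sum.cong) (auto simp: indicator_def)
      finally show ?case .
    qed
  qed
  also have "\<dots> = (\<Sum>k\<le>N. ennreal ((1/2) ^ k * (4 / (2 ^ k * \<delta>))) * emeasure M (cball z (2 ^ k * \<delta>)))"
  proof -
    have [measurable]: "cball z s \<in> sets M" for s by (simp add: sets_M)
    show ?thesis by (subst nn_integral_sum) (simp_all add: nn_integral_cmult_indicator)
  qed
  also have "\<dots> = (\<Sum>k\<le>N. ennreal ((1/2) ^ k) * ennreal (4 / (2 ^ k * \<delta>) * measure M (cball z (2 ^ k * \<delta>))))"
    using assms(1) by (intro sum.cong) (auto simp: emeasure_eq_measure mult.assoc simp flip: ennreal_mult)
  finally show ?thesis .
qed

lemma measure_cball_circle_measurable [measurable]:
  "(\<lambda>\<theta>. measure M (cball (of_real r * cis \<theta>) s)) \<in> borel_measurable borel"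
proof -
  have "{x \<in> space (borel \<Otimes>\<^sub>M M). cmod (of_real r * cis (fst x) - snd x) \<le> s} \<in> sets (borel \<Otimes>\<^sub>M M)"
    by measurable
  from measurable_emeasure_Pair[OF this] show ?thesis
    by (simp add: measure_def vimage_def space_pair_measure cball_def dist_norm sets_eq_imp_space_eq[OF sets_M])
qed

lemma measure_carleson_box_measurable [measurable]:
  assumes "\<delta> < 1"
  shows "(\<lambda>\<phi>. measure M (carleson_box \<phi> \<delta>)) \<in> borel_measurable borel"
proof -
  have "sets (borel \<Otimes>\<^sub>M M) = sets (borel \<Otimes>\<^sub>M (borel :: complex measure))"
    by (intro sets_pair_measure_cong sets_M) simp
  from measurable_emeasure_Pair[of "{x. snd x \<in> carleson_box (fst x) \<delta>}" borel, unfolded this,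
      OF carleson_box_measurable_pair[OF assms]]
  show ?thesis by (simp add: measure_def vimage_def)
qed

text \<open>
Jensen's inequality for the weights $2^{-k}$, whose sum is at most $2$, reduces the claim to the single
terms. The $k$-th one contributes $s^{-p} s^{\gamma p}$ with $s = 2^k\delta \ge \delta$, and since
$\gamma \le 1$ the worst case is $s = \delta$.
\<close>

lemma circle_box_average_le:
  fixes p \<gamma> \<delta> K :: real
  assumes "0 < \<delta>" "\<delta> \<le> 1" "1 < p" "\<gamma> \<le> 1" "0 \<le> K"
  defines "z \<equiv> \<lambda>\<theta>. of_real (1 - \<delta>) * cis \<theta>"
  assumes balls: "\<And>s. \<delta> \<le> s \<Longrightarrow>
    (\<integral>\<^sup>+\<theta>\<in>{0..2*pi}. ennreal (measure M (cball (z \<theta>) s) powr p) \<partial>lborel) \<le> ennreal (K * s powr (\<gamma> * p))"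
  shows "(\<integral>\<^sup>+\<theta>\<in>{0..2*pi}. ennpow p (box_average M \<delta> (z \<theta>)) \<partial>lborel)
    \<le> ennreal (2 * 8 powr p * K * \<delta> powr ((\<gamma> - 1) * p))"
proof -
  \<comment> \<open>the ball of radius \<open>2 ^ N * \<delta>\<close> about a point of the disc contains the disc\<close>
  obtain N where "2 / \<delta> < 2 ^ N" using real_arch_pow[of 2 "2 / \<delta>"] by auto
  then have N: "2 \<le> 2 ^ N * \<delta>" using assms(1) by (simp add: field_simps)
  define y where "y = (\<lambda>\<theta> k. 4 / (2 ^ k * \<delta>) * measure M (cball (z \<theta>) (2 ^ k * \<delta>)))"
  have y0: "0 \<le> y \<theta> k" for \<theta> k using assms(1) by (simp add: y_def)
  have [measurable]: "(\<lambda>\<theta>. y \<theta> k) \<in> borel_measurable borel" for k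
    unfolding y_def z_def by measurable
  have [measurable]: "(\<lambda>\<theta>. measure M (cball (z \<theta>) s)) \<in> borel_measurable borel" for s
    unfolding z_def by measurable
  have geo: "(\<Sum>k\<le>N. (1/2) ^ k) \<le> (2::real)"
    using sum_gp_basic[of "1/2::real" N] by simp
  have pw: "ennpow p (box_average M \<delta> (z \<theta>)) \<le> ennreal (2 powr p) * (\<Sum>k\<le>N. ennreal ((1/2) ^ k) * ennreal (y \<theta> k powr p))" for \<theta>
  proof -
    have "cmod (z \<theta>) \<le> 1" using assms(1,2) by (simp add: z_def norm_mult del: of_real_diff)
    then have "ennpow p (box_average M \<delta> (z \<theta>)) \<le> ennpow p (\<Sum>k\<le>N. ennreal ((1/2) ^ k) * ennreal (y \<theta> k))"
      unfolding y_def using assms(3) by (intro ennpow_mono box_average_dyadic_le N assms(1)) auto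
    also have "\<dots> \<le> ennpow (p - 1) (ennreal (\<Sum>k\<le>N. (1/2) ^ k)) * (\<Sum>k\<le>N. ennreal ((1/2) ^ k) * ennpow p (ennreal (y \<theta> k)))"
      by (rule ennpow_sum_Jensen) (use assms(3) in auto)
    also have "\<dots> \<le> ennreal (2 powr p) * (\<Sum>k\<le>N. ennreal ((1/2) ^ k) * ennpow p (ennreal (y \<theta> k)))"
    proof (rule mult_right_mono)
      have "ennpow (p - 1) (ennreal (\<Sum>k\<le>N. (1/2) ^ k)) = ennreal ((\<Sum>k\<le>N. (1/2) ^ k) powr (p - 1))"
        by (rule ennpow_ennreal) (simp add: sum_nonneg)
      also have "\<dots> \<le> ennreal (2 powr (p - 1))"
        using geo assms(3) by (intro ennreal_leI powr_mono2) (auto simp: sum_nonneg)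
      also have "\<dots> \<le> ennreal (2 powr p)" by (intro ennreal_leI powr_mono) auto
      finally show "ennpow (p - 1) (ennreal (\<Sum>k\<le>N. (1/2) ^ k)) \<le> ennreal (2 powr p)" .
    qed simp
    finally show ?thesis by (simp add: ennpow_ennreal y0)
  qed
  have term_le: "(\<integral>\<^sup>+\<theta>\<in>{0..2*pi}. ennreal (y \<theta> k powr p) \<partial>lborel) \<le> ennreal (4 powr p * K * \<delta> powr ((\<gamma> - 1) * p))" for k
  proof -
    define s where "s = 2 ^ k * \<delta>"
    have s: "\<delta> \<le> s" "0 < s" using assms(1) by (auto simp: s_def mult_le_cancel_right1)
    have "y \<theta> k powr p = (4 / s) powr p * measure M (cball (z \<theta>) s) powr p" for \<theta>
      unfolding y_def s_def[symmetric] by (rule powr_mult)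
    then have "(\<integral>\<^sup>+\<theta>\<in>{0..2*pi}. ennreal (y \<theta> k powr p) \<partial>lborel)
      = ennreal ((4 / s) powr p) * (\<integral>\<^sup>+\<theta>\<in>{0..2*pi}. ennreal (measure M (cball (z \<theta>) s) powr p) \<partial>lborel)"
      by (subst nn_integral_cmult[symmetric]) (auto simp: ennreal_mult' mult.assoc)
    also have "\<dots> \<le> ennreal ((4 / s) powr p) * ennreal (K * s powr (\<gamma> * p))"
      by (intro mult_left_mono balls s) auto
    also have "\<dots> = ennreal (4 powr p * K * s powr ((\<gamma> - 1) * p))"
    proof -
      have "(4 / s) powr p * (K * s powr (\<gamma> * p)) = 4 powr p * K * s powr ((\<gamma> - 1) * p)"
        unfolding powr_pred_mult by (simp add: powr_divide)
      then show ?thesis using assms(5) by (simp flip: ennreal_mult)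
    qed
    also have "\<dots> \<le> ennreal (4 powr p * K * \<delta> powr ((\<gamma> - 1) * p))"
      using s assms by (intro ennreal_leI mult_left_mono powr_mono2') (auto simp: mult_nonpos_nonneg)
    finally show ?thesis .
  qed
  have "(\<integral>\<^sup>+\<theta>\<in>{0..2*pi}. ennpow p (box_average M \<delta> (z \<theta>)) \<partial>lborel)
    \<le> (\<integral>\<^sup>+\<theta>. ennreal (2 powr p) * (\<Sum>k\<le>N. ennreal ((1/2) ^ k) * (ennreal (y \<theta> k powr p) * indicator {0..2*pi} \<theta>)) \<partial>lborel)"
    using mult_right_mono[OF pw, of "indicator {0..2*pi} _"]
    by (intro nn_integral_mono) (auto simp: sum_distrib_right mult.assoc)
  also have "\<dots> = ennreal (2 powr p) * (\<Sum>k\<le>N. ennreal ((1/2) ^ k) * (\<integral>\<^sup>+\<theta>\<in>{0..2*pi}. ennreal (y \<theta> k powr p) \<partial>lborel))"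
    by (simp add: nn_integral_cmult nn_integral_sum)
  also have "\<dots> \<le> ennreal (2 powr p) * (\<Sum>k\<le>N. ennreal ((1/2) ^ k) * ennreal (4 powr p * K * \<delta> powr ((\<gamma> - 1) * p)))"
    by (intro mult_left_mono sum_mono term_le) auto
  also have "\<dots> = ennreal (2 powr p * ((\<Sum>k\<le>N. (1/2) ^ k) * (4 powr p * K * \<delta> powr ((\<gamma> - 1) * p))))"
    using assms(5) by (simp add: sum_ennreal sum_nonneg sum_distrib_right flip: ennreal_mult)
  also have "\<dots> \<le> ennreal (2 powr p * (2 * (4 powr p * K * \<delta> powr ((\<gamma> - 1) * p))))"
    using geo assms(5) by (intro ennreal_leI mult_left_mono mult_right_mono) auto
  also have "2 powr p * (2 * (4 powr p * K * \<delta> powr ((\<gamma> - 1) * p))) = 2 * (2 powr p * 4 powr p) * K * \<delta> powr ((\<gamma> - 1) * p)"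
    by simp
  also have "2 powr p * 4 powr p = 8 powr p" by (simp flip: powr_mult)
  finally show ?thesis .
qed

lemma nn_integral_period_const: "0 \<le> c \<Longrightarrow> (\<integral>\<^sup>+\<theta>\<in>{0..2*pi}. ennreal c \<partial>lborel) = ennreal (2 * pi * c)"
  by (simp add: nn_integral_cmult_indicator mult.commute flip: ennreal_mult)

text \<open>
The weight is bounded by $1/\delta$, hence $U$ is bounded on the circle, and the comparison of $V$ with $U$
carries over to finiteness.
\<close>

lemma circle_potential_finite:
  assumes "0 < \<delta>" "\<delta> \<le> 1/2" "1 < p"
  shows "(\<integral>\<^sup>+\<theta>\<in>{0..2*pi}. ennpow p (potential M (of_real (1 - \<delta>) * cis \<theta>)) \<partial>lborel) < top"
proof -
  define c where "c = (measure M (space M) / \<delta>) powr p"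
  have "ennpow p (box_average M \<delta> z) \<le> ennreal c" for z
    using ennpow_mono[OF _ box_average_le[OF assms(1)], of p z] assms by (simp add: ennpow_ennreal c_def)
  then have "(\<integral>\<^sup>+\<theta>\<in>{0..2*pi}. ennpow p (box_average M \<delta> (of_real (1 - \<delta>) * cis \<theta>)) \<partial>lborel)
    \<le> (\<integral>\<^sup>+\<theta>\<in>{0..2*pi}. ennreal c \<partial>lborel)"
    by (intro nn_integral_mono mult_right_mono) auto
  also have "\<dots> < top" by (subst nn_integral_period_const) (auto simp: c_def)
  finally show ?thesis
    using circle_potential_le[OF assms] by (auto simp: ennreal_mult_less_top intro: le_less_trans)
qed

lemma potential_ge_carleson_box:
  assumes "0 < \<delta>" "\<delta> < 1"
  shows "ennreal (measure M (carleson_box \<phi> \<delta>) / (200 * \<delta>)) \<le> potential M (of_real (1 - \<delta>) * cis \<phi>)"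
proof -
  have box: "carleson_box \<phi> \<delta> \<in> sets M" by (simp add: sets_M carleson_box_borel assms)
  have "ennreal (measure M (carleson_box \<phi> \<delta>) / (200 * \<delta>))
    = (\<integral>\<^sup>+\<zeta>. ennreal (1 / (200 * \<delta>)) * indicator (carleson_box \<phi> \<delta>) \<zeta> \<partial>M)"
    using box assms by (simp add: nn_integral_cmult_indicator emeasure_eq_measure flip: ennreal_mult)
  also have "\<dots> \<le> potential M (of_real (1 - \<delta>) * cis \<phi>)"
    unfolding potential_def
  proof (rule nn_integral_mono)
    fix \<zeta>
    show "ennreal (1 / (200 * \<delta>)) * indicator (carleson_box \<phi> \<delta>) \<zeta> \<le> complete_kernel (of_real (1 - \<delta>) * cis \<phi>) \<zeta>"
    proof (cases "\<zeta> \<in> carleson_box \<phi> \<delta>")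
      case True
      have "cmod \<zeta> \<le> 1" "1 - \<delta> \<le> cmod \<zeta>" using True by (auto simp: carleson_box_def)
      moreover have "cmod (of_real (1 - \<delta>) * cis \<phi>) = 1 - \<delta>"
        using assms by (simp add: norm_mult del: of_real_diff)
      ultimately show ?thesis
        using complete_kernel_ge[OF assms _ _ _ carleson_box_dist_le[OF assms True]] True by simp
    qed simp
  qed
  finally show ?thesis .
qed

lemma measure_cball_le_carleson_box:
  assumes "0 < \<delta>" "\<delta> \<le> s" "s < 1/4"
  shows "measure M (cball (of_real (1 - \<delta>) * cis \<theta>) s) \<le> measure M (carleson_box \<theta> (2 * s))"
proof -
  have "AE \<zeta> in M. \<zeta> \<in> cball (of_real (1 - \<delta>) * cis \<theta>) s \<longrightarrow> \<zeta> \<in> carleson_box \<theta> (2 * s)"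
    using AE_M by eventually_elim (use cball_subset_carleson_box[OF assms, of \<theta>] in \<open>auto simp: dist_norm\<close>)
  moreover have "carleson_box \<theta> (2 * s) \<in> sets M" using assms by (simp add: sets_M carleson_box_borel)
  ultimately have "emeasure M (cball (of_real (1 - \<delta>) * cis \<theta>) s) \<le> emeasure M (carleson_box \<theta> (2 * s))"
    by (rule emeasure_mono_AE)
  then show ?thesis by (simp add: emeasure_eq_measure)
qed

end

section \<open>Growth of the means\<close>

context disc_measure
begin

text \<open>
The potential condition concerns small $\delta$ only, the box condition all $\delta < 1$; the difference is
absorbed by the total mass, which bounds the box means for $\delta$ away from $0$. In the other direction
the total mass takes care of the balls of radius at least $1/4$, which need not fit into a box.
\<close>

lemma circle_potential_growth_iff_box_growth:
  fixes p \<gamma> :: real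
  assumes "1 < p" "0 < \<gamma>" "\<gamma> \<le> 1"
  shows "(\<exists>K\<ge>0. \<exists>\<delta>\<^sub>0>0. \<forall>\<delta>\<in>{0<..<\<delta>\<^sub>0}.
      (\<integral>\<^sup>+\<theta>\<in>{0..2*pi}. ennpow p (potential M (of_real (1 - \<delta>) * cis \<theta>)) \<partial>lborel)
        \<le> ennreal (K * \<delta> powr ((\<gamma> - 1) * p)))
    \<longleftrightarrow> (\<exists>K\<ge>0. \<forall>\<delta>\<in>{0<..<1}.
      (\<integral>\<^sup>+\<phi>\<in>{0..2*pi}. ennreal (measure M (carleson_box \<phi> \<delta>) powr p) \<partial>lborel)
        \<le> ennreal (K * \<delta> powr (\<gamma> * p)))"
    (is "(\<exists>K\<ge>0. \<exists>\<delta>\<^sub>0>0. \<forall>\<delta>\<in>_. ?E \<delta> \<le> _) \<longleftrightarrow> (\<exists>K\<ge>0. \<forall>\<delta>\<in>_. ?B \<delta> \<le> _)")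
proof
  assume "\<exists>K\<ge>0. \<exists>\<delta>\<^sub>0>0. \<forall>\<delta>\<in>{0<..<\<delta>\<^sub>0}. ?E \<delta> \<le> ennreal (K * \<delta> powr ((\<gamma> - 1) * p))"
  then obtain K \<delta>\<^sub>0 where K: "0 \<le> K" "0 < \<delta>\<^sub>0"
    and E: "\<And>\<delta>. 0 < \<delta> \<Longrightarrow> \<delta> < \<delta>\<^sub>0 \<Longrightarrow> ?E \<delta> \<le> ennreal (K * \<delta> powr ((\<gamma> - 1) * p))" by auto
  define \<Lambda> where "\<Lambda> = measure M (space M) powr p"
  define K' where "K' = 200 powr p * K + 2 * pi * \<Lambda> / \<delta>\<^sub>0 powr (\<gamma> * p)"
  have K'0: "0 \<le> K'" using K by (simp add: K'_def \<Lambda>_def)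
  show "\<exists>K\<ge>0. \<forall>\<delta>\<in>{0<..<1}. ?B \<delta> \<le> ennreal (K * \<delta> powr (\<gamma> * p))"
  proof (intro exI conjI ballI)
    show "0 \<le> K'" by fact
    fix \<delta> :: real assume "\<delta> \<in> {0<..<1}"
    then have \<delta>: "0 < \<delta>" "\<delta> < 1" by auto
    show "?B \<delta> \<le> ennreal (K' * \<delta> powr (\<gamma> * p))"
    proof (cases "\<delta> < \<delta>\<^sub>0")
      case True
      have pw: "ennreal (measure M (carleson_box \<phi> \<delta>) powr p)
        \<le> ennreal ((200 * \<delta>) powr p) * ennpow p (potential M (of_real (1 - \<delta>) * cis \<phi>))" for \<phi>
      proof -
        have "measure M (carleson_box \<phi> \<delta>) powr p
          = (200 * \<delta>) powr p * (measure M (carleson_box \<phi> \<delta>) / (200 * \<delta>)) powr p"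
          using \<delta> by (simp flip: powr_mult)
        then have "ennreal (measure M (carleson_box \<phi> \<delta>) powr p)
          = ennreal ((200 * \<delta>) powr p) * ennpow p (ennreal (measure M (carleson_box \<phi> \<delta>) / (200 * \<delta>)))"
          using \<delta> by (simp only: ennreal_mult'[OF powr_ge_zero]) (simp add: ennpow_ennreal)
        also have "\<dots> \<le> ennreal ((200 * \<delta>) powr p) * ennpow p (potential M (of_real (1 - \<delta>) * cis \<phi>))"
          using assms(1) by (intro mult_left_mono ennpow_mono potential_ge_carleson_box \<delta>) auto
        finally show ?thesis .
      qed
      have "?B \<delta> \<le> (\<integral>\<^sup>+\<phi>. ennreal ((200 * \<delta>) powr p) *
          (ennpow p (potential M (of_real (1 - \<delta>) * cis \<phi>)) * indicator {0..2*pi} \<phi>) \<partial>lborel)"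
        using mult_right_mono[OF pw, of "indicator {0..2*pi} _"]
        by (intro nn_integral_mono) (simp add: mult.assoc)
      also have "\<dots> = ennreal ((200 * \<delta>) powr p) * ?E \<delta>"
        by (rule nn_integral_cmult) simp
      also have "\<dots> \<le> ennreal ((200 * \<delta>) powr p) * ennreal (K * \<delta> powr ((\<gamma> - 1) * p))"
        by (intro mult_left_mono E \<delta> True) simp
      also have "\<dots> = ennreal (200 powr p * K * \<delta> powr (\<gamma> * p))"
        using \<delta> K by (simp add: powr_mult powr_pred_mult flip: ennreal_mult)
      also have "\<dots> \<le> ennreal (K' * \<delta> powr (\<gamma> * p))"
        by (intro ennreal_leI mult_right_mono) (auto simp: K'_def \<Lambda>_def)
      finally show ?thesis .
    next
      case False
      have "?B \<delta> \<le> (\<integral>\<^sup>+\<phi>\<in>{0..2*pi}. ennreal \<Lambda> \<partial>lborel)"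
        unfolding \<Lambda>_def using assms(1)
        by (intro nn_integral_mono mult_right_mono ennreal_leI powr_mono2 bounded_measure) auto
      also have "\<dots> = ennreal (2 * pi * \<Lambda>)"
        by (rule nn_integral_period_const) (simp add: \<Lambda>_def)
      also have "\<dots> \<le> ennreal (K' * \<delta> powr (\<gamma> * p))"
      proof (rule ennreal_leI)
        have "2 * pi * \<Lambda> = 2 * pi * \<Lambda> / \<delta>\<^sub>0 powr (\<gamma> * p) * \<delta>\<^sub>0 powr (\<gamma> * p)"
          using K by simp
        also have "\<dots> \<le> K' * \<delta> powr (\<gamma> * p)"
          using False K assms by (intro mult_mono powr_mono2) (auto simp: K'_def \<Lambda>_def)
        finally show "2 * pi * \<Lambda> \<le> K' * \<delta> powr (\<gamma> * p)" .
      qed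
      finally show ?thesis .
    qed
  qed
next
  assume "\<exists>K\<ge>0. \<forall>\<delta>\<in>{0<..<1}. ?B \<delta> \<le> ennreal (K * \<delta> powr (\<gamma> * p))"
  then obtain K where K: "0 \<le> K"
    and B: "\<And>\<delta>. 0 < \<delta> \<Longrightarrow> \<delta> < 1 \<Longrightarrow> ?B \<delta> \<le> ennreal (K * \<delta> powr (\<gamma> * p))" by auto
  define \<Lambda> where "\<Lambda> = measure M (space M) powr p"
  define K' where "K' = K * 2 powr (\<gamma> * p) + 2 * pi * \<Lambda> * 4 powr (\<gamma> * p)"
  have K'0: "0 \<le> K'" using K by (simp add: K'_def \<Lambda>_def)
  define C where "C = 18 * (144 * (1 + 2 * p)) powr p * (2 * 8 powr p * K')"
  show "\<exists>K\<ge>0. \<exists>\<delta>\<^sub>0>0. \<forall>\<delta>\<in>{0<..<\<delta>\<^sub>0}. ?E \<delta> \<le> ennreal (K * \<delta> powr ((\<gamma> - 1) * p))"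
  proof (intro exI conjI ballI)
    show "0 \<le> C" using K'0 by (simp add: C_def)
    show "(0::real) < 1/2" by simp
    fix \<delta> :: real assume "\<delta> \<in> {0<..<1/2}"
    then have \<delta>: "0 < \<delta>" "\<delta> \<le> 1/2" by auto
    have balls: "(\<integral>\<^sup>+\<theta>\<in>{0..2*pi}. ennreal (measure M (cball (of_real (1 - \<delta>) * cis \<theta>) s) powr p) \<partial>lborel)
      \<le> ennreal (K' * s powr (\<gamma> * p))" if s: "\<delta> \<le> s" for s
    proof (cases "s < 1/4")
      case True
      have "(\<integral>\<^sup>+\<theta>\<in>{0..2*pi}. ennreal (measure M (cball (of_real (1 - \<delta>) * cis \<theta>) s) powr p) \<partial>lborel) \<le> ?B (2 * s)"
        using assms(1)
        by (intro nn_integral_mono mult_right_mono ennreal_leI powr_mono2 measure_cball_le_carleson_box \<delta> s True) auto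
      also have "\<dots> \<le> ennreal (K * (2 * s) powr (\<gamma> * p))"
        using True s \<delta> by (intro B) auto
      also have "\<dots> \<le> ennreal (K' * s powr (\<gamma> * p))"
        unfolding powr_mult mult.assoc[symmetric]
        by (intro ennreal_leI mult_right_mono) (auto simp: K'_def \<Lambda>_def)
      finally show ?thesis .
    next
      case False
      have "(\<integral>\<^sup>+\<theta>\<in>{0..2*pi}. ennreal (measure M (cball (of_real (1 - \<delta>) * cis \<theta>) s) powr p) \<partial>lborel)
        \<le> (\<integral>\<^sup>+\<phi>\<in>{0..2*pi}. ennreal \<Lambda> \<partial>lborel)"
        unfolding \<Lambda>_def using assms(1)
        by (intro nn_integral_mono mult_right_mono ennreal_leI powr_mono2 bounded_measure) auto
      also have "\<dots> = ennreal (2 * pi * \<Lambda>)"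
        by (rule nn_integral_period_const) (simp add: \<Lambda>_def)
      also have "\<dots> \<le> ennreal (K' * s powr (\<gamma> * p))"
      proof (rule ennreal_leI)
        have "1 \<le> (4 * s) powr (\<gamma> * p)"
          using False assms by (intro ge_one_powr_ge_zero) auto
        then have "2 * pi * \<Lambda> * 1 \<le> 2 * pi * \<Lambda> * (4 * s) powr (\<gamma> * p)"
          by (intro mult_left_mono) (auto simp: \<Lambda>_def)
        also have "\<dots> = 2 * pi * \<Lambda> * 4 powr (\<gamma> * p) * s powr (\<gamma> * p)"
          by (simp add: powr_mult)
        also have "\<dots> \<le> K' * s powr (\<gamma> * p)"
          using K by (intro mult_right_mono) (auto simp: K'_def)
        finally show "2 * pi * \<Lambda> \<le> K' * s powr (\<gamma> * p)" by simp
      qed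
      finally show ?thesis .
    qed
    have "?E \<delta> \<le> ennreal (18 * (144 * (1 + 2 * p)) powr p) *
        (\<integral>\<^sup>+\<theta>\<in>{0..2*pi}. ennpow p (box_average M \<delta> (of_real (1 - \<delta>) * cis \<theta>)) \<partial>lborel)"
      by (intro circle_potential_le \<delta> assms(1))
    also have "\<dots> \<le> ennreal (18 * (144 * (1 + 2 * p)) powr p) * ennreal (2 * 8 powr p * K' * \<delta> powr ((\<gamma> - 1) * p))"
      using \<delta> by (intro mult_left_mono circle_box_average_le assms K'0 balls) auto
    also have "\<dots> = ennreal (C * \<delta> powr ((\<gamma> - 1) * p))"
      using K'0 by (simp add: C_def mult.assoc flip: ennreal_mult)
    finally show "?E \<delta> \<le> ennreal (C * \<delta> powr ((\<gamma> - 1) * p))" .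
  qed
qed

lemma box_mean_growth_iff:
  fixes p \<gamma> :: real
  assumes "1 < p"
  shows "(\<exists>K. \<forall>\<delta>\<in>{0<..<1}. box_mean p M \<delta> \<le> K * \<delta> powr \<gamma>)
    \<longleftrightarrow> (\<exists>K\<ge>0. \<forall>\<delta>\<in>{0<..<1}.
      (\<integral>\<^sup>+\<phi>\<in>{0..2*pi}. ennreal (measure M (carleson_box \<phi> \<delta>) powr p) \<partial>lborel)
        \<le> ennreal (K * \<delta> powr (\<gamma> * p)))"
    (is "_ \<longleftrightarrow> (\<exists>K\<ge>0. \<forall>\<delta>\<in>_. ?B \<delta> \<le> _)")
proof -
  define b where "b = (\<lambda>\<delta>. LBINT \<phi>:{0..2*pi}. measure M (carleson_box \<phi> \<delta>) powr p)"
  have b0: "0 \<le> b \<delta>" for \<delta> unfolding b_def set_lebesgue_integral_def by (intro Bochner_Integration.integral_nonneg) auto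
  have B: "?B \<delta> = ennreal (b \<delta>)" if "\<delta> < 1" for \<delta>
  proof -
    have "?B \<delta> \<le> (\<integral>\<^sup>+\<phi>\<in>{0..2*pi}. ennreal (measure M (space M) powr p) \<partial>lborel)"
      using assms(1)
      by (intro nn_integral_mono mult_right_mono ennreal_leI powr_mono2 bounded_measure) auto
    also have "\<dots> < top" by (subst nn_integral_period_const) auto
    finally have fin: "?B \<delta> < top" .
    have [measurable]: "(\<lambda>\<phi>. measure M (carleson_box \<phi> \<delta>)) \<in> borel_measurable borel"
      by (rule measure_carleson_box_measurable[OF that])
    have "b \<delta> = enn2real (\<integral>\<^sup>+\<phi>. ennreal (indicator {0..2*pi} \<phi> *\<^sub>R measure M (carleson_box \<phi> \<delta>) powr p) \<partial>lborel)"
      unfolding b_def set_lebesgue_integral_def by (rule integral_eq_nn_integral) auto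
    also have "(\<integral>\<^sup>+\<phi>. ennreal (indicator {0..2*pi} \<phi> *\<^sub>R measure M (carleson_box \<phi> \<delta>) powr p) \<partial>lborel) = ?B \<delta>"
      by (intro nn_integral_cong) (auto simp: indicator_def)
    finally show ?thesis using fin by simp
  qed
  have mean: "box_mean p M \<delta> = b \<delta> powr (1 / p)" for \<delta> by (simp add: box_mean_def b_def)
  show ?thesis
  proof
    assume "\<exists>K. \<forall>\<delta>\<in>{0<..<1}. box_mean p M \<delta> \<le> K * \<delta> powr \<gamma>"
    then obtain K where "\<forall>\<delta>\<in>{0<..<1}. box_mean p M \<delta> \<le> K * \<delta> powr \<gamma>" by blast
    then have K: "box_mean p M \<delta> \<le> K * \<delta> powr \<gamma>" if "0 < \<delta>" "\<delta> < 1" for \<delta> using that by simp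
    show "\<exists>K\<ge>0. \<forall>\<delta>\<in>{0<..<1}. ?B \<delta> \<le> ennreal (K * \<delta> powr (\<gamma> * p))"
    proof (intro exI[of _ "\<bar>K\<bar> powr p"] conjI ballI)
      fix \<delta> :: real assume "\<delta> \<in> {0<..<1}"
      then have \<delta>: "0 < \<delta>" "\<delta> < 1" by auto
      have "b \<delta> powr (1 / p) \<le> \<bar>K\<bar> * \<delta> powr \<gamma>"
        using K[OF \<delta>] mult_right_mono[OF abs_ge_self powr_ge_zero, of K \<delta> \<gamma>] by (simp add: mean)
      then have "(b \<delta> powr (1 / p)) powr p \<le> (\<bar>K\<bar> * \<delta> powr \<gamma>) powr p"
        using assms by (intro powr_mono2) auto
      then have "b \<delta> \<le> \<bar>K\<bar> powr p * \<delta> powr (\<gamma> * p)"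
        using assms b0[of \<delta>] by (simp add: powr_powr powr_mult)
      then show "?B \<delta> \<le> ennreal (\<bar>K\<bar> powr p * \<delta> powr (\<gamma> * p))"
        using B[OF \<delta>(2)] by (simp add: ennreal_leI)
    qed simp
  next
    assume "\<exists>K\<ge>0. \<forall>\<delta>\<in>{0<..<1}. ?B \<delta> \<le> ennreal (K * \<delta> powr (\<gamma> * p))"
    then obtain K where K: "0 \<le> K" "\<And>\<delta>. 0 < \<delta> \<Longrightarrow> \<delta> < 1 \<Longrightarrow> ?B \<delta> \<le> ennreal (K * \<delta> powr (\<gamma> * p))" by auto
    show "\<exists>K. \<forall>\<delta>\<in>{0<..<1}. box_mean p M \<delta> \<le> K * \<delta> powr \<gamma>"
    proof (intro exI[of _ "K powr (1 / p)"] ballI)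
      fix \<delta> :: real assume "\<delta> \<in> {0<..<1}"
      then have \<delta>: "0 < \<delta>" "\<delta> < 1" by auto
      have "b \<delta> \<le> K * \<delta> powr (\<gamma> * p)"
        using K(2)[OF \<delta>] K(1) unfolding B[OF \<delta>(2)] by (simp add: ennreal_le_iff)
      then have "b \<delta> powr (1 / p) \<le> (K * \<delta> powr (\<gamma> * p)) powr (1 / p)"
        using assms b0 by (intro powr_mono2) auto
      then show "box_mean p M \<delta> \<le> K powr (1 / p) * \<delta> powr \<gamma>"
        using assms by (simp add: mean powr_mult powr_powr)
    qed
  qed
qed

end

text \<open>
Passing from $V$ to $u = C - V$ costs a constant. This inequality is true even where $V = \infty$, since the
right-hand side is infinite there; the converse one fails at such points, where the real value of $u$ is
$0$ by convention.
\<close>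

lemma ennpow_abs_shift_le:
  assumes "0 < p"
  shows "ennreal (\<bar>real_of_ereal (- enn2ereal v + ereal C)\<bar> powr p)
    \<le> ennreal (2 powr p) * (ennpow p v + ennreal (\<bar>C\<bar> powr p))"
proof (cases v)
  case (real a)
  have "ennreal \<bar>- a + C\<bar> \<le> ennreal a + ennreal \<bar>C\<bar>"
    using real by (simp flip: ennreal_plus add: ennreal_leI)
  then have "ennpow p (ennreal \<bar>- a + C\<bar>) \<le> ennpow p (ennreal a + ennreal \<bar>C\<bar>)"
    by (rule ennpow_mono[OF assms])
  also have "\<dots> \<le> ennreal (2 powr p) * (ennpow p (ennreal a) + ennpow p (ennreal \<bar>C\<bar>))"
    by (rule ennpow_add_le[OF assms])
  finally show ?thesis using real by (simp add: ennpow_ennreal enn2ereal_ennreal)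
next
  case top
  then show ?thesis by (simp add: ennreal_mult_top)
qed

lemma ennpow_le_abs_shift:
  assumes "0 < p" "v \<noteq> top"
  shows "ennpow p v
    \<le> ennreal (2 powr p) * (ennreal (\<bar>real_of_ereal (- enn2ereal v + ereal C)\<bar> powr p) + ennreal (\<bar>C\<bar> powr p))"
proof -
  obtain a where a: "v = ennreal a" "0 \<le> a" using assms(2) by (cases v) auto
  have "ennreal a \<le> ennreal \<bar>- a + C\<bar> + ennreal \<bar>C\<bar>"
    using a by (simp flip: ennreal_plus add: ennreal_leI)
  then have "ennpow p (ennreal a) \<le> ennpow p (ennreal \<bar>- a + C\<bar> + ennreal \<bar>C\<bar>)"
    by (rule ennpow_mono[OF assms(1)])
  also have "\<dots> \<le> ennreal (2 powr p) * (ennpow p (ennreal \<bar>- a + C\<bar>) + ennpow p (ennreal \<bar>C\<bar>))"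
    by (rule ennpow_add_le[OF assms(1)])
  finally show ?thesis using a by (simp add: ennpow_ennreal enn2ereal_ennreal)
qed

context disc_measure
begin

text \<open>
Both comparisons of $V$ with $u$ are integrated over the circle. The finiteness of $\int V^p$ shows that
$V = \infty$ happens on a null set only, and that the Bochner integral defining the mean agrees with
the integral in $[0,\infty]$. The constant is harmless because $1 \le \delta^{(\gamma-1)p}$.
\<close>

lemma m_mean_growth_iff:
  fixes p \<gamma> C :: real and u :: "complex \<Rightarrow> ereal"
  assumes "1 < p" "\<gamma> \<le> 1"
    and u: "\<And>z. z \<in> ball 0 1 \<Longrightarrow> u z = - enn2ereal (potential M z) + ereal C"
  shows "(\<lambda>r. m_mean p r u) \<in> O[at_left 1](\<lambda>r. (1 - r) powr (\<gamma> - 1))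
    \<longleftrightarrow> (\<exists>K\<ge>0. \<exists>\<delta>\<^sub>0>0. \<forall>\<delta>\<in>{0<..<\<delta>\<^sub>0}.
      (\<integral>\<^sup>+\<theta>\<in>{0..2*pi}. ennpow p (potential M (of_real (1 - \<delta>) * cis \<theta>)) \<partial>lborel)
        \<le> ennreal (K * \<delta> powr ((\<gamma> - 1) * p)))"
    (is "_ \<longleftrightarrow> (\<exists>K\<ge>0. \<exists>\<delta>\<^sub>0>0. \<forall>\<delta>\<in>_. ?E \<delta> \<le> _)")
proof -
  define F where "F = (\<lambda>\<delta> \<theta>. \<bar>real_of_ereal (- enn2ereal (potential M (of_real (1 - \<delta>) * cis \<theta>)) + ereal C)\<bar> powr p)"
  have [measurable]: "F \<delta> \<in> borel_measurable borel" for \<delta> unfolding F_def by measurable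
  define I where "I = (\<lambda>\<delta>. LBINT t:{0..2*pi}. F \<delta> t)"
  define D where "D = 2 * pi * \<bar>C\<bar> powr p"
  have D: "(\<integral>\<^sup>+\<theta>\<in>{0..2*pi}. ennreal (\<bar>C\<bar> powr p) \<partial>lborel) = ennreal D" "0 \<le> D"
    by (subst nn_integral_period_const) (auto simp: D_def)
  have I0: "0 \<le> I \<delta>" for \<delta> unfolding I_def set_lebesgue_integral_def by (intro Bochner_Integration.integral_nonneg) (auto simp: F_def)
  have mean: "m_mean p (1 - \<delta>) u = (I \<delta> / (2 * pi)) powr (1 / p)" if \<delta>: "0 < \<delta>" "\<delta> < 1" for \<delta>
  proof -
    have "of_real (1 - \<delta>) * cis t \<in> ball 0 1" for t
      using \<delta> by (simp add: norm_mult del: of_real_diff)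
    then show ?thesis by (simp add: m_mean_def I_def F_def u)
  qed
  have J1: "(\<integral>\<^sup>+\<theta>\<in>{0..2*pi}. ennreal (F \<delta> \<theta>) \<partial>lborel) \<le> ennreal (2 powr p) * (?E \<delta> + ennreal D)" for \<delta>
  proof -
    have "(\<integral>\<^sup>+\<theta>\<in>{0..2*pi}. ennreal (F \<delta> \<theta>) \<partial>lborel)
      \<le> (\<integral>\<^sup>+\<theta>. ennreal (2 powr p) * (ennpow p (potential M (of_real (1 - \<delta>) * cis \<theta>)) * indicator {0..2*pi} \<theta>
          + ennreal (\<bar>C\<bar> powr p) * indicator {0..2*pi} \<theta>) \<partial>lborel)"
      unfolding F_def using ennpow_abs_shift_le[of p] assms(1)
      by (intro nn_integral_mono) (auto simp: indicator_def)
    also have "\<dots> = ennreal (2 powr p) * (?E \<delta> + ennreal D)"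
      by (subst nn_integral_cmult, simp, subst nn_integral_add) (simp_all only: D, simp_all)
    finally show ?thesis .
  qed
  have fin: "?E \<delta> < top" if "0 < \<delta>" "\<delta> \<le> 1/2" for \<delta>
    by (rule circle_potential_finite[OF that assms(1)])
  have I: "(\<integral>\<^sup>+\<theta>\<in>{0..2*pi}. ennreal (F \<delta> \<theta>) \<partial>lborel) = ennreal (I \<delta>)" if \<delta>: "0 < \<delta>" "\<delta> \<le> 1/2" for \<delta>
  proof -
    have "(\<integral>\<^sup>+\<theta>\<in>{0..2*pi}. ennreal (F \<delta> \<theta>) \<partial>lborel) < top"
      by (rule le_less_trans[OF J1]) (use fin[OF \<delta>] in \<open>auto simp: ennreal_mult_less_top\<close>)
    moreover have "I \<delta> = enn2real (\<integral>\<^sup>+\<theta>. ennreal (indicator {0..2*pi} \<theta> *\<^sub>R F \<delta> \<theta>) \<partial>lborel)"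
      unfolding I_def set_lebesgue_integral_def by (rule integral_eq_nn_integral) (auto simp: F_def)
    moreover have "(\<integral>\<^sup>+\<theta>. ennreal (indicator {0..2*pi} \<theta> *\<^sub>R F \<delta> \<theta>) \<partial>lborel) = (\<integral>\<^sup>+\<theta>\<in>{0..2*pi}. ennreal (F \<delta> \<theta>) \<partial>lborel)"
      by (intro nn_integral_cong) (auto simp: indicator_def)
    ultimately show ?thesis by simp
  qed
  have J2: "?E \<delta> \<le> ennreal (2 powr p * (I \<delta> + D))" if \<delta>: "0 < \<delta>" "\<delta> \<le> 1/2" for \<delta>
  proof -
    have "AE \<theta> in lborel. ennpow p (potential M (of_real (1 - \<delta>) * cis \<theta>)) * indicator {0..2*pi} \<theta> \<noteq> \<infinity>"
      using fin[OF \<delta>] by (intro nn_integral_PInf_AE) auto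
    then have "?E \<delta> \<le> (\<integral>\<^sup>+\<theta>. ennreal (2 powr p) * (ennreal (F \<delta> \<theta>) * indicator {0..2*pi} \<theta>
          + ennreal (\<bar>C\<bar> powr p) * indicator {0..2*pi} \<theta>) \<partial>lborel)"
    proof (intro nn_integral_mono_AE, eventually_elim)
      case (elim \<theta>)
      show ?case
      proof (cases "\<theta> \<in> {0..2*pi}")
        case True
        then have "potential M (of_real (1 - \<delta>) * cis \<theta>) \<noteq> top" using elim by auto
        from ennpow_le_abs_shift[OF _ this, of p C] show ?thesis
          using True assms(1) by (simp add: F_def)
      qed simp
    qed
    also have "\<dots> = ennreal (2 powr p) * (ennreal (I \<delta>) + ennreal D)"
      by (subst nn_integral_cmult, simp, subst nn_integral_add) (simp_all only: D I[OF \<delta>], simp_all)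
    also have "\<dots> = ennreal (2 powr p * (I \<delta> + D))"
      using I0 D by (simp add: ennreal_mult)
    finally show ?thesis .
  qed
  have one_le: "1 \<le> \<delta> powr ((\<gamma> - 1) * p)" if "0 < \<delta>" "\<delta> \<le> 1/2" for \<delta>
    using that assms powr_mono2'[of "(\<gamma> - 1) * p" \<delta> 1] by (simp add: mult_nonpos_nonneg)
  show ?thesis
  proof
    assume "(\<lambda>r. m_mean p r u) \<in> O[at_left 1](\<lambda>r. (1 - r) powr (\<gamma> - 1))"
    then obtain c where c: "0 < c" "eventually (\<lambda>r. norm (m_mean p r u) \<le> c * norm ((1 - r) powr (\<gamma> - 1))) (at_left 1)"
      by (elim landau_o.bigE) auto
    then obtain a where a: "a < 1" "\<And>r. a < r \<Longrightarrow> r < 1 \<Longrightarrow> \<bar>m_mean p r u\<bar> \<le> c * (1 - r) powr (\<gamma> - 1)"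
      unfolding eventually_at_left_field by auto
    define K where "K = 2 powr p * (2 * pi * c powr p + D)"
    show "\<exists>K\<ge>0. \<exists>\<delta>\<^sub>0>0. \<forall>\<delta>\<in>{0<..<\<delta>\<^sub>0}. ?E \<delta> \<le> ennreal (K * \<delta> powr ((\<gamma> - 1) * p))"
    proof (intro exI conjI ballI)
      show "0 \<le> K" using D by (simp add: K_def)
      show "0 < min (1 - a) (1/2)" using a by simp
      fix \<delta> assume "\<delta> \<in> {0<..<min (1 - a) (1/2)}"
      then have \<delta>: "0 < \<delta>" "\<delta> \<le> 1/2" "\<delta> < 1" "\<delta> < 1 - a" by auto
      have "(I \<delta> / (2 * pi)) powr (1 / p) \<le> c * \<delta> powr (\<gamma> - 1)"
        using a(2)[of "1 - \<delta>"] \<delta> by (simp add: mean)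
      then have "((I \<delta> / (2 * pi)) powr (1 / p)) powr p \<le> (c * \<delta> powr (\<gamma> - 1)) powr p"
        using assms by (intro powr_mono2) auto
      also have "\<dots> = c powr p * \<delta> powr ((\<gamma> - 1) * p)" by (simp add: powr_mult powr_powr)
      finally have "I \<delta> \<le> 2 * pi * c powr p * \<delta> powr ((\<gamma> - 1) * p)"
        using I0[of \<delta>] assms(1) by (simp add: powr_powr field_simps)
      moreover have "D * 1 \<le> D * \<delta> powr ((\<gamma> - 1) * p)"
        using D one_le[OF \<delta>(1,2)] by (intro mult_left_mono) auto
      ultimately have "2 powr p * (I \<delta> + D) \<le> 2 powr p * (2 * pi * c powr p * \<delta> powr ((\<gamma> - 1) * p) + D * \<delta> powr ((\<gamma> - 1) * p))"
        by (intro mult_left_mono) auto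
      also have "\<dots> = K * \<delta> powr ((\<gamma> - 1) * p)" by (simp add: K_def algebra_simps)
      finally show "?E \<delta> \<le> ennreal (K * \<delta> powr ((\<gamma> - 1) * p))"
        using J2[OF \<delta>(1,2)] by (meson ennreal_leI order_trans)
    qed
  next
    assume "\<exists>K\<ge>0. \<exists>\<delta>\<^sub>0>0. \<forall>\<delta>\<in>{0<..<\<delta>\<^sub>0}. ?E \<delta> \<le> ennreal (K * \<delta> powr ((\<gamma> - 1) * p))"
    then obtain K \<delta>\<^sub>0 where K: "0 \<le> K" "0 < \<delta>\<^sub>0"
      and E: "\<And>\<delta>. 0 < \<delta> \<Longrightarrow> \<delta> < \<delta>\<^sub>0 \<Longrightarrow> ?E \<delta> \<le> ennreal (K * \<delta> powr ((\<gamma> - 1) * p))" by auto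
    define B where "B = 2 powr p * (K + D) / (2 * pi)"
    show "(\<lambda>r. m_mean p r u) \<in> O[at_left 1](\<lambda>r. (1 - r) powr (\<gamma> - 1))"
    proof (rule landau_o.bigI[of "B powr (1 / p) + 1"])
      show "0 < B powr (1 / p) + 1" by (simp add: add_nonneg_pos)
      show "eventually (\<lambda>r. norm (m_mean p r u) \<le> (B powr (1 / p) + 1) * norm ((1 - r) powr (\<gamma> - 1))) (at_left 1)"
        unfolding eventually_at_left_field
      proof (intro exI[of _ "1 - min \<delta>\<^sub>0 (1/2)"] conjI allI impI)
        show "1 - min \<delta>\<^sub>0 (1/2) < 1" using K by simp
        fix r assume r: "1 - min \<delta>\<^sub>0 (1/2) < r" "r < 1"
        define \<delta> where "\<delta> = 1 - r"
        have \<delta>: "0 < \<delta>" "\<delta> \<le> 1/2" "\<delta> < \<delta>\<^sub>0" "\<delta> < 1" using r by (auto simp: \<delta>_def)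
        have "ennreal (I \<delta>) \<le> ennreal (2 powr p) * (ennreal (K * \<delta> powr ((\<gamma> - 1) * p)) + ennreal D)"
          using J1[of \<delta>] E[OF \<delta>(1,3)] unfolding I[OF \<delta>(1,2)]
          by (meson add_mono mult_left_mono order_refl order_trans zero_le)
        also have "\<dots> = ennreal (2 powr p * (K * \<delta> powr ((\<gamma> - 1) * p) + D))"
          using K D by (simp add: ennreal_mult)
        finally have "I \<delta> \<le> 2 powr p * (K * \<delta> powr ((\<gamma> - 1) * p) + D)"
          using K D by (subst (asm) ennreal_le_iff) auto
        also have "\<dots> \<le> 2 powr p * (K * \<delta> powr ((\<gamma> - 1) * p) + D * \<delta> powr ((\<gamma> - 1) * p))"
          using D one_le[OF \<delta>(1,2)] mult_left_mono[of 1 "\<delta> powr ((\<gamma> - 1) * p)" D]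
          by (intro mult_left_mono add_left_mono) auto
        also have "\<dots> = 2 * pi * (B * \<delta> powr ((\<gamma> - 1) * p))" by (simp add: B_def field_simps)
        finally have "I \<delta> / (2 * pi) \<le> B * \<delta> powr ((\<gamma> - 1) * p)" by (simp add: field_simps)
        then have "(I \<delta> / (2 * pi)) powr (1 / p) \<le> (B * \<delta> powr ((\<gamma> - 1) * p)) powr (1 / p)"
          using assms I0 by (intro powr_mono2) auto
        also have "\<dots> = B powr (1 / p) * \<delta> powr (\<gamma> - 1)"
          using assms by (simp add: powr_mult powr_powr)
        finally have "m_mean p r u \<le> B powr (1 / p) * \<delta> powr (\<gamma> - 1)"
          using mean[OF \<delta>(1,4)] by (simp add: \<delta>_def)
        moreover have "0 \<le> m_mean p r u" by (simp add: m_mean_def)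
        moreover have "B powr (1 / p) * \<delta> powr (\<gamma> - 1) \<le> (B powr (1 / p) + 1) * \<delta> powr (\<gamma> - 1)"
          by (intro mult_right_mono) auto
        ultimately show "norm (m_mean p r u) \<le> (B powr (1 / p) + 1) * norm ((1 - r) powr (\<gamma> - 1))"
          by (simp add: \<delta>_def)
      qed
    qed
  qed
qed

end

section \<open>The potential of a complete measure\<close>

lemma nn_integral_sum_measure:
  assumes sets: "sets N1 = sets M" "sets N2 = sets M"
    and em: "\<And>A. A \<in> sets M \<Longrightarrow> emeasure M A = emeasure N1 A + emeasure N2 A"
    and h: "h \<in> borel_measurable M"
  shows "(\<integral>\<^sup>+x. h x \<partial>M) = (\<integral>\<^sup>+x. h x \<partial>N1) + (\<integral>\<^sup>+x. h x \<partial>N2)"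
  using h
proof (induction rule: borel_measurable_induct)
  case (cong f g)
  have "(\<integral>\<^sup>+x. f x \<partial>N) = (\<integral>\<^sup>+x. g x \<partial>N)" if "sets N = sets M" for N
    using cong(3) sets_eq_imp_space_eq[OF that] by (intro nn_integral_cong) simp
  then show ?case using cong(4) sets by simp
next
  case (set A)
  then show ?case using em by (simp add: sets)
next
  case (mult f c)
  have [measurable]: "f \<in> borel_measurable N1" "f \<in> borel_measurable N2"
    using mult by (simp_all cong: measurable_cong_sets add: sets)
  show ?case using mult by (simp add: nn_integral_cmult distrib_left)
next
  case (add f g)
  have [measurable]: "f \<in> borel_measurable N1" "f \<in> borel_measurable N2"
    "g \<in> borel_measurable N1" "g \<in> borel_measurable N2"
    using add by (simp_all cong: measurable_cong_sets add: sets)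
  show ?case using add by (simp add: nn_integral_add ac_simps)
next
  case (seq F)
  have [measurable]: "F i \<in> borel_measurable N1" "F i \<in> borel_measurable N2" for i
    using seq(1)[of i] by (simp_all cong: measurable_cong_sets add: sets)
  have inc: "incseq (\<lambda>i. \<integral>\<^sup>+x. F i x \<partial>N)" for N
    using seq(3) by (auto simp: incseq_def le_fun_def intro!: nn_integral_mono)
  show ?case
    using seq
    by (simp add: SUP_apply[abs_def] image_comp nn_integral_monotone_convergence_SUP ennreal_SUP_add[OF inc inc])
qed

lemma measure_distr_restrict_cball:
  assumes sL: "sets L = sets (restrict_space borel (cball 0 1 :: complex set))"
    and A: "A \<in> sets borel"
  shows "emeasure (distr L borel (\<lambda>\<zeta>. \<zeta>)) A = emeasure L (A \<inter> cball 0 1)"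
proof -
  have sp: "space L = cball 0 1" using sets_eq_imp_space_eq[OF sL] by (simp add: space_restrict_space)
  have "(\<lambda>\<zeta>. \<zeta>) \<in> measurable (restrict_space borel (cball 0 1)) (borel :: complex measure)"
    by (rule measurable_restrict_space1) simp
  then have "(\<lambda>\<zeta>. \<zeta>) \<in> borel_measurable L"
    by (simp cong: measurable_cong_sets add: sL)
  then show ?thesis using A by (simp add: emeasure_distr sp Int_commute vimage_def)
qed

lemma complete_kernel_green:
  assumes "z \<in> ball 0 1" "\<zeta> \<in> ball 0 1"
  shows "e2ennreal (- elog (cmod (z - \<zeta>) / cmod (1 - z * cnj \<zeta>))) = ennreal (1 - cmod \<zeta>) * complete_kernel z \<zeta>"
proof (cases "z = \<zeta>")
  case True
  then show ?thesis using assms by (simp add: elog_def complete_kernel_def ennreal_mult_top)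
next
  case False
  have "cmod (z * cnj \<zeta>) < 1"
    using assms mult_strict_mono'[of "cmod z" 1 "cmod \<zeta>" 1] by (simp add: norm_mult)
  then have "1 - z * cnj \<zeta> \<noteq> 0" by auto
  then have n: "cmod (1 - z * cnj \<zeta>) > 0" by simp
  have d: "cmod (z - \<zeta>) > 0" using False by simp
  define l where "l = ln (cmod (1 - z * cnj \<zeta>) / cmod (z - \<zeta>))"
  have "- ln (cmod (z - \<zeta>) / cmod (1 - z * cnj \<zeta>)) = l"
    using n d by (simp add: l_def ln_div)
  then have "e2ennreal (- elog (cmod (z - \<zeta>) / cmod (1 - z * cnj \<zeta>))) = ennreal l"
    using n d by (simp add: elog_def)
  also have "\<dots> = ennreal ((1 - cmod \<zeta>) * (l / (1 - cmod \<zeta>)))" using assms by simp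
  also have "\<dots> = ennreal (1 - cmod \<zeta>) * ennreal (l / (1 - cmod \<zeta>))"
    using assms by (intro ennreal_mult') simp
  also have "ennreal (l / (1 - cmod \<zeta>)) = complete_kernel z \<zeta>"
    using assms False by (simp add: complete_kernel_def l_def)
  finally show ?thesis .
qed

lemma poisson_integral_eq:
  assumes "finite_measure \<psi>" and s: "sets \<psi> = sets (restrict_space borel (sphere 0 1))" and z: "z \<in> ball 0 1"
  shows "(\<integral>\<^sup>+\<zeta>. complete_kernel z \<zeta> \<partial>\<psi>) = ennreal (poisson_integral \<psi> z)" "0 \<le> poisson_integral \<psi> z"
proof -
  interpret finite_measure \<psi> by fact
  have sp: "space \<psi> = sphere 0 1" using sets_eq_imp_space_eq[OF s] by (simp add: space_restrict_space)
  define P where "P = (\<lambda>\<zeta>. (1 - (cmod z)\<^sup>2) / (2 * pi * (cmod (\<zeta> - z))\<^sup>2))"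
  have z2: "0 \<le> 1 - (cmod z)\<^sup>2" using z power_mono[of "cmod z" 1 2] by simp
  have P0: "0 \<le> P \<zeta>" for \<zeta> using z2 by (simp add: P_def)
  have "P \<in> borel_measurable (restrict_space borel (sphere 0 1))"
    unfolding P_def by (rule measurable_restrict_space1) measurable
  then have [measurable]: "P \<in> borel_measurable \<psi>" by (simp cong: measurable_cong_sets add: s)
  have int: "integrable \<psi> P"
  proof (rule integrable_const_bound)
    show "AE \<zeta> in \<psi>. norm (P \<zeta>) \<le> 1 / (1 - cmod z)\<^sup>2"
    proof (rule AE_I2)
      fix \<zeta> assume "\<zeta> \<in> space \<psi>"
      then have "cmod \<zeta> = 1" by (simp add: sp)
      then have "1 - cmod z \<le> cmod (\<zeta> - z)" using norm_triangle_ineq2[of \<zeta> z] by simp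
      then have "(1 - cmod z)\<^sup>2 \<le> (cmod (\<zeta> - z))\<^sup>2" using z by (intro power_mono) auto
      moreover have "1 \<le> 2 * pi" using pi_gt3 by simp
      ultimately have "1 * (1 - cmod z)\<^sup>2 \<le> 2 * pi * (cmod (\<zeta> - z))\<^sup>2" by (intro mult_mono) auto
      then have "P \<zeta> \<le> 1 / (1 - cmod z)\<^sup>2"
        unfolding P_def using z z2 by (intro frac_le) auto
      then show "norm (P \<zeta>) \<le> 1 / (1 - cmod z)\<^sup>2" using P0[of \<zeta>] by simp
    qed
  qed simp
  have eq: "poisson_integral \<psi> z = (\<integral>\<zeta>. P \<zeta> \<partial>\<psi>)"
    by (simp add: poisson_integral_def P_def flip: integral_mult_right_zero)
  have "(\<integral>\<^sup>+\<zeta>. complete_kernel z \<zeta> \<partial>\<psi>) = (\<integral>\<^sup>+\<zeta>. ennreal (P \<zeta>) \<partial>\<psi>)"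
    by (intro nn_integral_cong) (auto simp: sp complete_kernel_def P_def)
  also have "\<dots> = ennreal (poisson_integral \<psi> z)"
    unfolding eq using int P0 by (intro nn_integral_eq_integral) auto
  finally show "(\<integral>\<^sup>+\<zeta>. complete_kernel z \<zeta> \<partial>\<psi>) = ennreal (poisson_integral \<psi> z)" .
  show "0 \<le> poisson_integral \<psi> z" unfolding eq by (intro Bochner_Integration.integral_nonneg P0)
qed

text \<open>
The complete measure is the sum of the Riesz measure with density $1-|\zeta|$ and of $\psi$. Against the
kernel the first summand gives the Green potential, because the density cancels the denominator of the
kernel, and the second one gives the Poisson integral. Measurability of the identity says that the
$\sigma$-algebra of $\mu$ contains the traces of all Borel sets; that of the counting measure of the zeros contains
even all subsets of the disc.
\<close>

lemma complete_measure_potential: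
  assumes L: "is_complete_measure u \<mu> L" and \<mu>: "(\<lambda>\<zeta>. \<zeta>) \<in> borel_measurable \<mu>"
  obtains C where "disc_measure (distr L borel (\<lambda>\<zeta>. \<zeta>))"
    and "\<And>z. z \<in> ball 0 1 \<Longrightarrow> u z = - enn2ereal (potential (distr L borel (\<lambda>\<zeta>. \<zeta>)) z) + ereal C"
proof -
  define M where "M = distr L borel (\<lambda>\<zeta>. \<zeta>)"
  have sL: "sets L = sets (restrict_space borel (cball 0 1))" using L by (simp add: is_complete_measure_def)
  obtain \<psi> C where R: "represented_by u \<mu> \<psi> C"
    and LM: "\<And>A. A \<in> sets L \<Longrightarrow> emeasure L A =
           (\<integral>\<^sup>+\<zeta>\<in>ball 0 1 \<inter> A. ennreal (1 - cmod \<zeta>) \<partial>\<mu>) + emeasure \<psi> (A \<inter> sphere 0 1)"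
    using L by (auto simp: is_complete_measure_def)
  have fin: "(\<integral>\<^sup>+\<zeta>\<in>ball 0 1. ennreal (1 - cmod \<zeta>) \<partial>\<mu>) < \<infinity>"
    and \<psi>: "finite_measure \<psi>" "sets \<psi> = sets (restrict_space borel (sphere 0 1))"
    and u: "\<And>z. z \<in> ball 0 1 \<Longrightarrow> u z = - enn2ereal (green_potential \<mu> z) - ereal (poisson_integral \<psi> z) + ereal C"
    using R by (auto simp: represented_by_def)
  interpret \<psi>: finite_measure \<psi> by fact
  have sp\<psi>: "space \<psi> = sphere 0 1" using sets_eq_imp_space_eq[OF \<psi>(2)] by (simp add: space_restrict_space)
  note [measurable] = \<mu>
  define w where "w = (\<lambda>\<zeta>::complex. ennreal (1 - cmod \<zeta>) * indicator (ball 0 1) \<zeta>)"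
  have [measurable]: "ball 0 1 \<in> sets (borel :: complex measure)" by simp
  have [measurable]: "w \<in> borel_measurable borel" unfolding w_def by measurable
  have w\<mu>: "(\<lambda>\<zeta>. h \<zeta>) \<in> borel_measurable \<mu>" if "h \<in> borel_measurable borel" for h :: "complex \<Rightarrow> ennreal"
    using measurable_compose[OF \<mu> that] .
  have [measurable]: "w \<in> borel_measurable \<mu>" by (rule w\<mu>) simp
  define N1 where "N1 = distr (density \<mu> w) borel (\<lambda>\<zeta>. \<zeta>)"
  define N2 where "N2 = distr \<psi> borel (\<lambda>\<zeta>. \<zeta>)"
  have id\<psi> [measurable]: "(\<lambda>\<zeta>. \<zeta>) \<in> borel_measurable \<psi>"
  proof -
    have "(\<lambda>\<zeta>. \<zeta>) \<in> borel_measurable (restrict_space borel (sphere 0 1 :: complex set))"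
      by (rule measurable_restrict_space1) simp
    then show ?thesis by (simp cong: measurable_cong_sets add: \<psi>(2))
  qed
  have em: "emeasure M A = emeasure N1 A + emeasure N2 A" if A: "A \<in> sets borel" for A
  proof -
    have "emeasure M A = emeasure L (A \<inter> cball 0 1)"
      unfolding M_def by (rule measure_distr_restrict_cball[OF sL A])
    also have "A \<inter> cball 0 1 \<in> sets L" using A by (auto simp: sL sets_restrict_space)
    then have "emeasure L (A \<inter> cball 0 1) =
           (\<integral>\<^sup>+\<zeta>\<in>ball 0 1 \<inter> (A \<inter> cball 0 1). ennreal (1 - cmod \<zeta>) \<partial>\<mu>) + emeasure \<psi> (A \<inter> cball 0 1 \<inter> sphere 0 1)"
      by (rule LM)
    also have "A \<inter> cball 0 1 \<inter> sphere 0 1 = A \<inter> space \<psi>" by (auto simp: sp\<psi>)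
    also have "emeasure \<psi> (A \<inter> space \<psi>) = emeasure N2 A"
      using A by (simp add: N2_def emeasure_distr vimage_def Int_commute)
    also have "(\<integral>\<^sup>+\<zeta>\<in>ball 0 1 \<inter> (A \<inter> cball 0 1). ennreal (1 - cmod \<zeta>) \<partial>\<mu>) = (\<integral>\<^sup>+\<zeta>. indicator A \<zeta> \<partial>N1)"
    proof -
      have "(\<integral>\<^sup>+\<zeta>. indicator A \<zeta> \<partial>N1) = (\<integral>\<^sup>+\<zeta>. indicator A \<zeta> \<partial>density \<mu> w)"
        unfolding N1_def using A by (intro nn_integral_distr) auto
      also have "\<dots> = (\<integral>\<^sup>+\<zeta>. w \<zeta> * indicator A \<zeta> \<partial>\<mu>)"
        using A by (intro nn_integral_density w\<mu>) auto
      also have "\<dots> = (\<integral>\<^sup>+\<zeta>\<in>ball 0 1 \<inter> (A \<inter> cball 0 1). ennreal (1 - cmod \<zeta>) \<partial>\<mu>)"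
        by (intro nn_integral_cong) (auto simp: w_def indicator_def)
      finally show ?thesis by simp
    qed
    also have "\<dots> = emeasure N1 A" using A by (simp add: N1_def)
    finally show ?thesis .
  qed
  have "disc_measure M"
  proof (intro disc_measure.intro finite_measureI disc_measure_axioms.intro)
    show "emeasure M (space M) \<noteq> \<infinity>"
    proof -
      have "emeasure M (space M) = emeasure N1 UNIV + emeasure N2 UNIV" using em[of UNIV] by (simp add: M_def)
      also have "emeasure N1 UNIV = (\<integral>\<^sup>+\<zeta>. w \<zeta> \<partial>\<mu>)"
        by (simp add: N1_def emeasure_distr emeasure_density cong: nn_integral_cong)
      also have "emeasure N2 UNIV = emeasure \<psi> (space \<psi>)"
        by (simp add: N2_def emeasure_distr)
      finally show ?thesis using fin by (simp add: w_def less_top)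
    qed
    show "sets M = sets borel" by (simp add: M_def)
    have "emeasure M (- cball 0 1) = emeasure L {}"
      unfolding M_def by (subst measure_distr_restrict_cball[OF sL]) auto
    then show "AE \<zeta> in M. cmod \<zeta> \<le> 1"
      by (intro AE_I[of _ _ "- cball 0 1"]) (auto simp: M_def)
  qed
  moreover have "u z = - enn2ereal (potential M z) + ereal C" if z: "z \<in> ball 0 1" for z
  proof -
    have "potential M z = (\<integral>\<^sup>+\<zeta>. complete_kernel z \<zeta> \<partial>N1) + (\<integral>\<^sup>+\<zeta>. complete_kernel z \<zeta> \<partial>N2)"
      unfolding potential_def
      by (rule nn_integral_sum_measure) (auto simp: M_def N1_def N2_def em[unfolded M_def N1_def N2_def])
    also have "(\<integral>\<^sup>+\<zeta>. complete_kernel z \<zeta> \<partial>N2) = (\<integral>\<^sup>+\<zeta>. complete_kernel z \<zeta> \<partial>\<psi>)"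
      unfolding N2_def by (intro nn_integral_distr) auto
    also have "\<dots> = ennreal (poisson_integral \<psi> z)" by (rule poisson_integral_eq[OF \<psi> z])
    also have "(\<integral>\<^sup>+\<zeta>. complete_kernel z \<zeta> \<partial>N1) = (\<integral>\<^sup>+\<zeta>. complete_kernel z \<zeta> \<partial>density \<mu> w)"
      unfolding N1_def by (intro nn_integral_distr) auto
    also have "\<dots> = (\<integral>\<^sup>+\<zeta>. w \<zeta> * complete_kernel z \<zeta> \<partial>\<mu>)"
      by (intro nn_integral_density w\<mu>) auto
    also have "\<dots> = green_potential \<mu> z"
      unfolding green_potential_def
      by (intro nn_integral_cong) (auto simp: w_def indicator_def complete_kernel_green[OF z])
    finally have V: "potential M z = green_potential \<mu> z + ennreal (poisson_integral \<psi> z)" .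
    have P0: "0 \<le> poisson_integral \<psi> z" by (rule poisson_integral_eq(2)[OF \<psi> z])
    show ?thesis
      unfolding u[OF z] V using P0
      by (cases "green_potential \<mu> z") (auto simp: enn2ereal_ennreal simp flip: ennreal_plus)
  qed
  ultimately show thesis using that by (simp add: M_def)
qed

lemma box_mean_distr:
  assumes sL: "sets L = sets (restrict_space borel (cball 0 1))" and "\<delta> < 1"
  shows "box_mean p (distr L borel (\<lambda>\<zeta>. \<zeta>)) \<delta> = box_mean p L \<delta>"
proof -
  have "measure (distr L borel (\<lambda>\<zeta>. \<zeta>)) (carleson_box \<phi> \<delta>) = measure L (carleson_box \<phi> \<delta>)" for \<phi>
  proof -
    have "carleson_box \<phi> \<delta> \<inter> cball 0 1 = carleson_box \<phi> \<delta>" by (auto simp: carleson_box_def)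
    then show ?thesis
      using measure_distr_restrict_cball[OF sL carleson_box_borel[OF assms(2)], of \<phi>] by (simp add: measure_def)
  qed
  then show ?thesis by (simp add: box_mean_def)
qed

section \<open>Means of \<open>log |f|\<close> and Carleson boxes\<close>

theorem theorem2:
  fixes f :: "complex \<Rightarrow> complex" and \<gamma> p :: real and L :: "complex measure"
  assumes "f holomorphic_on ball 0 1"
    and "bounded (f ` ball 0 1)"
    and "\<exists>z\<in>ball 0 1. f z \<noteq> 0"
    and "0 < \<gamma>" and "\<gamma> \<le> 1"
    and "1 < p"
    and "is_complete_measure (log_abs f) (zero_measure f) L"
  shows "(\<lambda>r. m_mean p r (log_abs f)) \<in> O[at_left 1](\<lambda>r. (1 - r) powr (\<gamma> - 1))
    \<longleftrightarrow> (\<exists>K. \<forall>\<delta>\<in>{0<..<1}. box_mean p L \<delta> \<le> K * \<delta> powr \<gamma>)"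
proof -
  have "(\<lambda>\<zeta>. \<zeta>) \<in> borel_measurable (zero_measure f)"
    by (simp add: zero_measure_def)
  from complete_measure_potential[OF assms(7) this] obtain C
    where M: "disc_measure (distr L borel (\<lambda>\<zeta>. \<zeta>))"
      and u: "\<And>z. z \<in> ball 0 1 \<Longrightarrow> log_abs f z = - enn2ereal (potential (distr L borel (\<lambda>\<zeta>. \<zeta>)) z) + ereal C"
    by blast
  have "sets L = sets (restrict_space borel (cball 0 1))"
    using assms(7) by (simp add: is_complete_measure_def)
  then have "box_mean p (distr L borel (\<lambda>\<zeta>. \<zeta>)) \<delta> = box_mean p L \<delta>" if "\<delta> \<in> {0<..<1}" for \<delta>
    using that by (intro box_mean_distr) auto
  then show ?thesis
    using disc_measure.m_mean_growth_iff[OF M assms(6,5) u]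
      disc_measure.circle_potential_growth_iff_box_growth[OF M assms(6,4,5)]
      disc_measure.box_mean_growth_iff[OF M assms(6), of \<gamma>]
    by simp
qed

end
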